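(* Let $\nabla$ be a compressed lattice polytope. If $\nabla$ has at most one singular vertex, then the toric ideal of $\nabla$ has a quadratic Gröbner basis (i.e. with respect to some monomial ordering it has a Gröbner basis consisting of elements of degree two).
   Context: A lattice polytope $\nabla\subset\mathbb{R}^d$ is the convex hull of a finite subset of $\mathbb{Z}^d$. Write its facet presentation as $\nabla=\{x\mid\langle x,a_F\rangle\ge c_F\text{ for all facets }F\}$, where $a_F$ is the primitive integer normal vector of the facet $F$ (if $\nabla$ is not full-dimensional, this is understood inside the affine span of $\nabla$ with its induced lattice). The width of $\nabla$ with respect to $F$ is $\max_{x\in\nabla}\{\langle x,a_F\rangle-c_F\}$. $\nabla$ is compressed if it has width one with respect to all of its facets. Compressed polytopes are normal: every lattice point of $k\nabla$ is a sum of $k$ lattice points of $\nabla$, for all $k\ge1$. A vertex $v$ of $\nabla$ is smooth if the ray generators of $\mathrm{Cone}(\nabla-v)=\{\lambda x\mid x\in\nabla-v,\ \lambda\in\mathbb{R}_{\geq 0}\}$ (the lattice points closest to the origin on its edges) form part of a $\mathbb{Z}$-basis of $\mathbb{Z}^d$; otherwise $v$ is singular. Toric ideal: if $\nabla$ has lattice points $m_1,\dots,m_k$, let $S(\nabla)=\{(m,\lambda)\in\mathbb{Z}^d\times\mathbb{Z}\mid \lambda\ge 0,\ m\in\lambda\nabla\}$ and let $\varphi:\mathbb{C}[t_1,\dots,t_k]\to\mathbb{C}[S(\nabla)]$ be the $\mathbb{C}$-algebra surjection $t_i\mapsto x^{(m_i,1)}$. The toric ideal of $\nabla$ is $\ker\varphi$,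 homogeneous for the standard grading (for the zero ideal, the empty set counts as a quadratic Gröbner basis). *)

theory Defs
  imports "HOL-Analysis.Analysis" "HOL-Library.Poly_Mapping"
begin

section \<open>Lattice polytopes\<close>

definition integer_points :: "(real ^ 'n) set" where
  "integer_points = {x. \<forall>i. x $ i \<in> \<int>}"

definition lattice_polytope :: "(real ^ 'n) set \<Rightarrow> bool" where
  "lattice_polytope P \<longleftrightarrow>
     (\<exists>V. finite V \<and> V \<noteq> {} \<and> V \<subseteq> integer_points \<and> P = convex hull V)"


subsection \<open>Width and compressed polytopes\<close>

definition direction_space :: "(real ^ 'n) set \<Rightarrow> (real ^ 'n) set" where
  "direction_space P = span {x - y | x y. x \<in> P \<and> y \<in> P}"

text \<open>
  The dual of the lattice that the affine span of P inherits from the integer points, where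
  a linear form on the direction space is represented by the unique vector of that space
  inducing it via the inner product. If P is full-dimensional this is just the lattice of
  integer points (see \<open>dual_lattice_full_dim\<close> below).
\<close>
definition dual_lattice :: "(real ^ 'n) set \<Rightarrow> (real ^ 'n) set" where
  "dual_lattice P =
     {a \<in> direction_space P. \<forall>x \<in> direction_space P \<inter> integer_points. a \<bullet> x \<in> \<int>}"

definition primitive_in :: "(real ^ 'n) set \<Rightarrow> real ^ 'n \<Rightarrow> bool" where
  "primitive_in L a \<longleftrightarrow>
     a \<in> L \<and> a \<noteq> 0 \<and> (\<forall>b \<in> L. \<forall>k::nat. a = real k *\<^sub>R b \<longrightarrow> k = 1)"

text \<open>For a facet F of a lattice polytope P exactly one pair (a, c) has this property.\<close>
definition facet_inequality ::
    "(real ^ 'n) set \<Rightarrow> (real ^ 'n) set \<Rightarrow> real ^ 'n \<Rightarrow> real \<Rightarrow> bool" where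
  "facet_inequality P F a c \<longleftrightarrow>
     primitive_in (dual_lattice P) a \<and> (\<forall>x \<in> P. a \<bullet> x \<ge> c) \<and> F = {x \<in> P. a \<bullet> x = c}"

text \<open>The supremum is a maximum for compact nonempty P.\<close>
definition width :: "(real ^ 'n) set \<Rightarrow> real ^ 'n \<Rightarrow> real \<Rightarrow> real" where
  "width P a c = (SUP x\<in>P. a \<bullet> x - c)"

definition compressed :: "(real ^ 'n) set \<Rightarrow> bool" where
  "compressed P \<longleftrightarrow>
     (\<forall>F. F facet_of P \<longrightarrow> (\<exists>a c. facet_inequality P F a c \<and> width P a c = 1))"


subsection \<open>Smooth and singular vertices\<close>

definition vertex_cone :: "(real ^ 'n) set \<Rightarrow> real ^ 'n \<Rightarrow> (real ^ 'n) set" where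
  "vertex_cone P v = {l *\<^sub>R (x - v) | l x. x \<in> P \<and> 0 \<le> l}"

definition ray_generators :: "(real ^ 'n) set \<Rightarrow> (real ^ 'n) set" where
  "ray_generators C =
     {u. \<exists>E. E edge_of C \<and> u \<in> E \<inter> integer_points - {0} \<and>
             (\<forall>w \<in> E \<inter> integer_points - {0}. norm u \<le> norm w)}"

definition is_lattice_basis :: "(real ^ 'n) set \<Rightarrow> bool" where
  "is_lattice_basis B \<longleftrightarrow>
     finite B \<and> B \<subseteq> integer_points \<and>
     (\<forall>x \<in> integer_points. \<exists>c::real ^ 'n \<Rightarrow> int. x = (\<Sum>b\<in>B. of_int (c b) *\<^sub>R b)) \<and>
     (\<forall>c::real ^ 'n \<Rightarrow> int. (\<Sum>b\<in>B. of_int (c b) *\<^sub>R b) = 0 \<longrightarrow> (\<forall>b\<in>B. c b = 0))"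

definition smooth_vertex :: "(real ^ 'n) set \<Rightarrow> real ^ 'n \<Rightarrow> bool" where
  "smooth_vertex P v \<longleftrightarrow>
     v extreme_point_of P \<and>
     (\<exists>B. is_lattice_basis B \<and> ray_generators (vertex_cone P v) \<subseteq> B)"

definition singular_vertex :: "(real ^ 'n) set \<Rightarrow> real ^ 'n \<Rightarrow> bool" where
  "singular_vertex P v \<longleftrightarrow> v extreme_point_of P \<and> \<not> smooth_vertex P v"


section \<open>Polynomials and Groebner bases\<close>

text \<open>
  A monomial is identified with its exponent vector. The type of polynomials provides one
  variable for every element of the index type; the polynomial ring in finitely many variables,
  indexed by A, consists of the polynomials in which no other variable occurs.
\<close>
type_synonym 'v monomial = "'v \<Rightarrow>\<^sub>0 nat"
type_synonym 'v polynomial = "'v monomial \<Rightarrow>\<^sub>0 complex"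

definition monomials_in :: "'v set \<Rightarrow> 'v monomial set" where
  "monomials_in A = {\<alpha>. Poly_Mapping.keys \<alpha> \<subseteq> A}"

definition polynomials_in :: "'v set \<Rightarrow> 'v polynomial set" where
  "polynomials_in A = {f. Poly_Mapping.keys f \<subseteq> monomials_in A}"

definition monomial_degree :: "'v monomial \<Rightarrow> nat" where
  "monomial_degree \<alpha> = (\<Sum>v\<in>Poly_Mapping.keys \<alpha>. Poly_Mapping.lookup \<alpha> v)"

definition homogeneous_of_degree :: "nat \<Rightarrow> 'v polynomial \<Rightarrow> bool" where
  "homogeneous_of_degree n f \<longleftrightarrow> (\<forall>\<alpha> \<in> Poly_Mapping.keys f. monomial_degree \<alpha> = n)"

text \<open>
  The membership \<open>(\<alpha>, \<beta>) \<in> r\<close> means that \<open>\<alpha>\<close> is at most \<open>\<beta>\<close>. For finite A, minimality of the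
  monomial 1 (exponent vector 0) makes r a well-order.
\<close>
definition monomial_ordering :: "'v set \<Rightarrow> 'v monomial rel \<Rightarrow> bool" where
  "monomial_ordering A r \<longleftrightarrow>
     linear_order_on (monomials_in A) r \<and>
     (\<forall>\<alpha> \<in> monomials_in A. (0, \<alpha>) \<in> r) \<and>
     (\<forall>\<alpha> \<beta>. \<forall>\<gamma> \<in> monomials_in A. (\<alpha>, \<beta>) \<in> r \<longrightarrow> (\<alpha> + \<gamma>, \<beta> + \<gamma>) \<in> r)"

text \<open>Only meaningful for nonzero polynomials.\<close>
definition leading_monomial :: "'v monomial rel \<Rightarrow> 'v polynomial \<Rightarrow> 'v monomial" where
  "leading_monomial r f =
     (THE \<alpha>. \<alpha> \<in> Poly_Mapping.keys f \<and> (\<forall>\<beta> \<in> Poly_Mapping.keys f. (\<beta>, \<alpha>) \<in> r))"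

definition ideal_generated :: "'v set \<Rightarrow> 'v polynomial set \<Rightarrow> 'v polynomial set" where
  "ideal_generated A G =
     {(\<Sum>g\<in>T. q g * g) | T q. finite T \<and> T \<subseteq> G \<and> (\<forall>g\<in>T. q g \<in> polynomials_in A)}"

definition leading_terms :: "'v monomial rel \<Rightarrow> 'v polynomial set \<Rightarrow> 'v polynomial set" where
  "leading_terms r F = {Poly_Mapping.single (leading_monomial r f) 1 | f. f \<in> F \<and> f \<noteq> 0}"

definition groebner_basis ::
    "'v set \<Rightarrow> 'v monomial rel \<Rightarrow> 'v polynomial set \<Rightarrow> 'v polynomial set \<Rightarrow> bool" where
  "groebner_basis A r I G \<longleftrightarrow>
     finite G \<and> G \<subseteq> I \<and>
     ideal_generated A (leading_terms r G) = ideal_generated A (leading_terms r I)"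

definition has_quadratic_groebner_basis :: "'v set \<Rightarrow> 'v polynomial set \<Rightarrow> bool" where
  "has_quadratic_groebner_basis A I \<longleftrightarrow>
     (\<exists>r G. monomial_ordering A r \<and> groebner_basis A r I G \<and>
            (\<forall>g \<in> G. g \<noteq> 0 \<and> homogeneous_of_degree 2 g))"


section \<open>Toric ideals\<close>

definition lattice_points :: "(real ^ 'n) set \<Rightarrow> (real ^ 'n) set" where
  "lattice_points P = P \<inter> integer_points"

definition polytope_semigroup :: "(real ^ 'n) set \<Rightarrow> ((real ^ 'n) \<times> int) set" where
  "polytope_semigroup P =
     {(m, l). m \<in> integer_points \<and> 0 \<le> l \<and> m \<in> (\<lambda>x. of_int l *\<^sub>R x) ` P}"

text \<open>
  The polynomial ring has one variable for each lattice point m of P, and m itself serves as the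
  index of its variable. The map is substitution of \<open>x\<^sup>(\<^sup>m\<^sup>,\<^sup>1\<^sup>)\<close> for the variable of m, with values in
  the algebra of the additive group \<open>\<real>\<^sup>n \<times> \<int>\<close>, which contains the semigroup algebra of
  \<open>polytope_semigroup P\<close> as the elements supported there; the lemmas below confirm that the
  map is an algebra homomorphism into that subalgebra.
\<close>
definition toric_hom :: "(real ^ 'n) polynomial \<Rightarrow> (((real ^ 'n) \<times> int) \<Rightarrow>\<^sub>0 complex)" where
  "toric_hom f =
     (\<Sum>\<alpha>\<in>Poly_Mapping.keys f. Poly_Mapping.single 0 (Poly_Mapping.lookup f \<alpha>) *
        (\<Prod>m\<in>Poly_Mapping.keys \<alpha>. Poly_Mapping.single (m, 1) 1 ^ Poly_Mapping.lookup \<alpha> m))"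

definition toric_ideal :: "(real ^ 'n) set \<Rightarrow> (real ^ 'n) polynomial set" where
  "toric_ideal P = {f \<in> polynomials_in (lattice_points P). toric_hom f = 0}"


section \<open>Consistency of the definitions\<close>

lemma dual_lattice_full_dim:
  fixes P :: "(real ^ 'n) set"
  assumes "direction_space P = UNIV"
  shows "dual_lattice P = integer_points"
proof -
  have "a \<in> integer_points" if "\<forall>x \<in> integer_points. a \<bullet> x \<in> \<int>" for a :: "real ^ 'n"
  proof -
    have "axis i 1 \<in> (integer_points :: (real ^ 'n) set)" for i
      by (auto simp: integer_points_def axis_def)
    then have "a \<bullet> axis i 1 \<in> \<int>" for i
      using that by blast
    then show ?thesis
      by (simp add: integer_points_def inner_axis)
  qed
  moreover have "a \<bullet> x \<in> \<int>" if "a \<in> integer_points" "x \<in> integer_points" for a x :: "real ^ 'n"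
    using that by (auto simp: integer_points_def inner_vec_def intro!: Ints_sum Ints_mult)
  ultimately show ?thesis
    using assms by (auto simp: dual_lattice_def)
qed

context
begin

private lemma poly_mapping_induct [case_names single sum]:
  fixes f :: "'a \<Rightarrow>\<^sub>0 'b::ab_group_add"
  assumes single: "\<And>a c. Q (Poly_Mapping.single a c)"
    and sum: "\<And>f g. Q f \<Longrightarrow> Q g \<Longrightarrow> Q (f + g)"
  shows "Q f"
proof -
  have zero: "Q 0" using single[of undefined 0] by simp
  have "Q (\<Sum>a\<in>S. Poly_Mapping.single a (Poly_Mapping.lookup f a))" if "finite S" for S
    using that by (induction S) (auto intro: zero single sum)
  moreover have "f = (\<Sum>a\<in>Poly_Mapping.keys f. Poly_Mapping.single a (Poly_Mapping.lookup f a))"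
    by (rule poly_mapping_eqI)
       (simp add: lookup_sum lookup_single when_def in_keys_iff sum.delta)
  ultimately show ?thesis by (metis finite_keys)
qed

private abbreviation mono_image :: "(real ^ 'n) monomial \<Rightarrow> (((real ^ 'n) \<times> int) \<Rightarrow>\<^sub>0 complex)" where
  "mono_image \<alpha> \<equiv>
     (\<Prod>m\<in>Poly_Mapping.keys \<alpha>. Poly_Mapping.single (m, 1) 1 ^ Poly_Mapping.lookup \<alpha> m)"

private lemma mono_image_superset:
  assumes "finite S" "Poly_Mapping.keys \<alpha> \<subseteq> S"
  shows "mono_image \<alpha> = (\<Prod>m\<in>S. Poly_Mapping.single (m, 1) 1 ^ Poly_Mapping.lookup \<alpha> m)"
  using assms by (intro prod.mono_neutral_left) (auto simp: in_keys_iff)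

private lemma mono_image_add: "mono_image (\<alpha> + \<beta>) = mono_image \<alpha> * mono_image \<beta>"
proof -
  let ?S = "Poly_Mapping.keys \<alpha> \<union> Poly_Mapping.keys \<beta>"
  have "Poly_Mapping.keys (\<alpha> + \<beta>) \<subseteq> ?S" by (rule Poly_Mapping.keys_add)
  then have "mono_image (\<alpha> + \<beta>) =
      (\<Prod>m\<in>?S. Poly_Mapping.single (m, 1) 1 ^ Poly_Mapping.lookup (\<alpha> + \<beta>) m)"
    by (intro mono_image_superset) auto
  also have "\<dots> = (\<Prod>m\<in>?S. Poly_Mapping.single (m, 1) 1 ^ Poly_Mapping.lookup \<alpha> m) *
      (\<Prod>m\<in>?S. Poly_Mapping.single (m, 1) 1 ^ Poly_Mapping.lookup \<beta> m)"
    by (simp add: lookup_add power_add prod.distrib)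
  also have "\<dots> = mono_image \<alpha> * mono_image \<beta>"
    by (intro arg_cong2[where f = "(*)"] mono_image_superset[symmetric]) auto
  finally show ?thesis .
qed

private lemma toric_hom_superset:
  assumes "finite S" "Poly_Mapping.keys f \<subseteq> S"
  shows "toric_hom f = (\<Sum>\<alpha>\<in>S. Poly_Mapping.single 0 (Poly_Mapping.lookup f \<alpha>) * mono_image \<alpha>)"
  unfolding toric_hom_def using assms
  by (intro sum.mono_neutral_left) (auto simp: in_keys_iff)

lemma toric_hom_add: "toric_hom (f + g) = toric_hom f + toric_hom g"
proof -
  let ?S = "Poly_Mapping.keys f \<union> Poly_Mapping.keys g"
  have "Poly_Mapping.keys (f + g) \<subseteq> ?S" by (rule Poly_Mapping.keys_add)
  then show ?thesis
    by (simp add: toric_hom_superset[of ?S] lookup_add single_add distrib_right sum.distrib)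
qed

private lemma toric_hom_single:
  "toric_hom (Poly_Mapping.single \<alpha> c) = Poly_Mapping.single 0 c * mono_image \<alpha>"
  by (simp add: toric_hom_def)

lemma toric_hom_const: "toric_hom (Poly_Mapping.single 0 c) = Poly_Mapping.single 0 c"
  by (simp add: toric_hom_single)

lemma toric_hom_variable:
  "toric_hom (Poly_Mapping.single (Poly_Mapping.single m 1) 1) = Poly_Mapping.single (m, 1) 1"
  by (simp add: toric_hom_single)

lemma toric_hom_mult:
  fixes f g :: "(real ^ 'n) polynomial"
  shows "toric_hom (f * g) = toric_hom f * toric_hom g"
proof -
  have single: "toric_hom (Poly_Mapping.single \<alpha> c * g) =
                toric_hom (Poly_Mapping.single \<alpha> c) * toric_hom g" for \<alpha> c
  proof (induction g rule: poly_mapping_induct)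
    case (single \<beta> d)
    have "Poly_Mapping.single 0 (c * d) = Poly_Mapping.single (0 :: (real ^ 'n) \<times> int) c *
          Poly_Mapping.single 0 d" for c d :: complex
      by (simp add: mult_single)
    then show ?case
      by (simp only: mult_single[of \<alpha> c] toric_hom_single mono_image_add mult.assoc mult.left_commute)
  qed (simp add: toric_hom_add distrib_left)
  show ?thesis
    by (induction f rule: poly_mapping_induct) (simp_all add: single toric_hom_add distrib_right)
qed

private lemma mono_image_eq_single:
  "mono_image \<alpha> = Poly_Mapping.single
     (\<Sum>m\<in>Poly_Mapping.keys \<alpha>. real (Poly_Mapping.lookup \<alpha> m) *\<^sub>R m,
      int (\<Sum>m\<in>Poly_Mapping.keys \<alpha>. Poly_Mapping.lookup \<alpha> m)) 1"
proof -
  have pow: "Poly_Mapping.single (m, 1) 1 ^ n =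
      (Poly_Mapping.single (real n *\<^sub>R m, int n) 1 :: ((real ^ 'n) \<times> int) \<Rightarrow>\<^sub>0 complex)"
    for m :: "real ^ 'n" and n
    by (induction n) (simp_all add: mult_single algebra_simps flip: single_one zero_prod_def)
  have "(\<Prod>m\<in>S. Poly_Mapping.single (h m, int (k m)) 1) =
      (Poly_Mapping.single (\<Sum>m\<in>S. h m, int (\<Sum>m\<in>S. k m)) 1 :: ((real ^ 'n) \<times> int) \<Rightarrow>\<^sub>0 complex)"
    if "finite S" for S and h :: "real ^ 'n \<Rightarrow> real ^ 'n" and k :: "real ^ 'n \<Rightarrow> nat"
    using that
    by (induction S) (simp_all add: mult_single flip: single_one zero_prod_def)
  then show ?thesis
    unfolding pow by (metis (no_types) finite_keys)
qed

lemma toric_hom_in_semigroup_algebra: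
  assumes "lattice_polytope P" and f: "f \<in> polynomials_in (lattice_points P)"
  shows "Poly_Mapping.keys (toric_hom f) \<subseteq> polytope_semigroup P"
proof -
  have P: "convex P" "P \<noteq> {}"
    using assms(1) by (auto simp: lattice_polytope_def)
  have "Poly_Mapping.keys (Poly_Mapping.single 0 c * mono_image \<alpha>) \<subseteq> polytope_semigroup P"
    if \<alpha>: "\<alpha> \<in> Poly_Mapping.keys f" for \<alpha> and c :: complex
  proof -
    let ?K = "Poly_Mapping.keys \<alpha>" and ?a = "Poly_Mapping.lookup \<alpha>"
    let ?s = "\<Sum>m\<in>?K. real (?a m) *\<^sub>R m" and ?l = "\<Sum>m\<in>?K. ?a m"
    have K: "?K \<subseteq> P" "?K \<subseteq> integer_points"
      using f \<alpha> by (auto simp: polynomials_in_def monomials_in_def lattice_points_def)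
    have "?s \<in> integer_points"
      using K(2) by (auto simp: integer_points_def intro!: Ints_sum Ints_mult)
    moreover have "?s \<in> (\<lambda>x. real ?l *\<^sub>R x) ` P"
    proof (cases "?l = 0")
      case True
      then show ?thesis using P(2) by auto
    next
      case False
      have "(\<Sum>m\<in>?K. (real (?a m) / real ?l) *\<^sub>R m) \<in> P"
        using False K(1) by (intro convex_sum P(1)) (auto simp flip: sum_divide_distrib of_nat_sum)
      moreover have "?s = real ?l *\<^sub>R (\<Sum>m\<in>?K. (real (?a m) / real ?l) *\<^sub>R m)"
        using False by (simp add: scaleR_sum_right del: of_nat_sum)
      ultimately show ?thesis by blast
    qed
    ultimately have "(?s, int ?l) \<in> polytope_semigroup P"
      by (simp add: polytope_semigroup_def del: of_nat_sum)
    then show ?thesis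
      by (simp add: mono_image_eq_single mult_single del: of_nat_sum)
  qed
  then show ?thesis
    unfolding toric_hom_def by (intro order_trans[OF keys_sum]) blast
qed

end

end

theory Submission
  imports Defs "HOL-Library.List_Lexorder"
begin

text \<open>
  At a smooth vertex \<open>w\<close> the edge directions \<open>U\<close> form part of a lattice basis, so \<open>P\<close> acquires integral
  nonnegative coordinates there. Width one with respect to the coordinate facets turns
  lattice points into 0/1 vectors, that is, into subsets of \<open>U\<close>. Every other facet that cuts something
  off has lattice distance one from \<open>w\<close> and, again by width one, says that the coordinates in
  some subset of \<open>U\<close> have sum at most 1. Hence the lattice points of \<open>P\<close> are the stable sets of a graph
  on \<open>U\<close>, in which \<open>u\<close> and \<open>v\<close> are adjacent if \<open>w + u + v \<notin> P\<close>
  (\<open>conflict_free_set_in_polytope\<close>, \<open>lattice_point_conflict_free\<close>).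

  If the vertex \<open>w + s\<close> is smooth as well, then \<open>s\<close> is simplicial: its neighbours are pairwise adjacent
  (\<open>smooth_neighbour_simplicial\<close>). With at most one singular vertex this holds for all of \<open>U\<close> but
  at most one element. Rank that element last and orient the edges of the graph by rank.
  Simpliciality makes this a partial order on \<open>U\<close> whose antichains are the stable sets and in which
  the elements above a given one form a chain. An antichain corresponds to the down-set that it
  generates. Passing from one to the other is a unitriangular linear change of
  coordinates, so that unions and intersections of down-sets yield relations \<open>a + b = c + d\<close>
  between lattice points (\<open>quadratic_groebner_basis\<close>).

  So the toric ideal is the Hibi ideal of a distributive lattice, and the classical argument applies
  (\<open>ring_of_sets_quadratic_groebner_basis\<close>): if the products of incomparable elements are the leading
  terms, then the irreducible monomials are supported on chains, and each fiber of the
  monomial map contains only one of those.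

  If no vertex is smooth, then there is only one vertex and \<open>P\<close> is a point.
\<close>

section \<open>Monomial orderings from weights\<close>

definition monomial_weight :: "('v \<Rightarrow> nat) \<Rightarrow> 'v monomial \<Rightarrow> nat" where
  "monomial_weight \<omega> \<alpha> = (\<Sum>v\<in>Poly_Mapping.keys \<alpha>. Poly_Mapping.lookup \<alpha> v * \<omega> v)"

lemma sum_keys_superset:
  assumes "finite S" "Poly_Mapping.keys \<alpha> \<subseteq> S" "\<And>v. h v 0 = 0"
  shows "(\<Sum>v\<in>Poly_Mapping.keys \<alpha>. h v (Poly_Mapping.lookup \<alpha> v)) =
         (\<Sum>v\<in>S. h v (Poly_Mapping.lookup \<alpha> v))"
  using assms by (intro sum.mono_neutral_left) (auto simp: in_keys_iff)

lemma sum_keys_add: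
  fixes \<alpha> \<beta> :: "'v monomial"
  assumes "\<And>v. h v 0 = 0" "\<And>v a b. h v (a + b) = h v a + h v b"
  shows "(\<Sum>v\<in>Poly_Mapping.keys (\<alpha> + \<beta>). h v (Poly_Mapping.lookup (\<alpha> + \<beta>) v)) =
         (\<Sum>v\<in>Poly_Mapping.keys \<alpha>. h v (Poly_Mapping.lookup \<alpha> v)) +
         (\<Sum>v\<in>Poly_Mapping.keys \<beta>. h v (Poly_Mapping.lookup \<beta> v))"
proof -
  let ?S = "Poly_Mapping.keys \<alpha> \<union> Poly_Mapping.keys \<beta>"
  have "Poly_Mapping.keys (\<alpha> + \<beta>) \<subseteq> ?S" by (rule Poly_Mapping.keys_add)
  then show ?thesis
    using sum_keys_superset[of ?S "\<alpha> + \<beta>" h] sum_keys_superset[of ?S \<alpha> h] sum_keys_superset[of ?S \<beta> h]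
    by (simp add: assms lookup_add sum.distrib)
qed

lemma monomial_weight_add [simp]:
  "monomial_weight \<omega> (\<alpha> + \<beta>) = monomial_weight \<omega> \<alpha> + monomial_weight \<omega> \<beta>"
  unfolding monomial_weight_def
  by (rule sum_keys_add[where h = "\<lambda>v n. n * \<omega> v"]) (simp_all add: algebra_simps)

lemma monomial_weight_single [simp]: "monomial_weight \<omega> (Poly_Mapping.single v n) = n * \<omega> v"
  by (simp add: monomial_weight_def)

lemma monomial_degree_add [simp]:
  "monomial_degree (\<alpha> + \<beta>) = monomial_degree \<alpha> + monomial_degree \<beta>"
  unfolding monomial_degree_def by (rule sum_keys_add[where h = "\<lambda>v n. n"]) simp_all

lemma monomial_degree_single [simp]: "monomial_degree (Poly_Mapping.single v n) = n"
  by (simp add: monomial_degree_def)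

lemma monomial_degree_eq_0_iff [simp]: "monomial_degree \<alpha> = 0 \<longleftrightarrow> \<alpha> = 0"
proof
  assume "monomial_degree \<alpha> = 0"
  then have "\<forall>v\<in>Poly_Mapping.keys \<alpha>. Poly_Mapping.lookup \<alpha> v = 0"
    unfolding monomial_degree_def by (subst (asm) sum_eq_0_iff) simp_all
  then have "Poly_Mapping.keys \<alpha> = {}" by (meson all_not_in_conv in_keys_iff)
  then show "\<alpha> = 0" by simp
qed (simp add: monomial_degree_def)

lemma zero_in_monomials_in [simp]: "0 \<in> monomials_in A"
  by (simp add: monomials_in_def)

lemma single_in_monomials_in [simp]: "v \<in> A \<Longrightarrow> Poly_Mapping.single v n \<in> monomials_in A"
  by (simp add: monomials_in_def)

lemma monomials_in_add [simp]:
  fixes \<alpha> \<beta> :: "'v monomial"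
  shows "\<alpha> + \<beta> \<in> monomials_in A \<longleftrightarrow> \<alpha> \<in> monomials_in A \<and> \<beta> \<in> monomials_in A"
  by (auto simp: monomials_in_def in_keys_iff lookup_add subset_iff)

lemma list_le_map_add:
  fixes f g h :: "'v \<Rightarrow> nat"
  assumes "map f xs \<le> map g xs"
  shows "map (\<lambda>x. f x + h x) xs \<le> map (\<lambda>x. g x + h x) xs"
  using assms by (induction xs) auto

lemma list_zero_le_map: "map (\<lambda>_. 0) xs \<le> map (g :: 'v \<Rightarrow> nat) xs"
  by (induction xs) auto

text \<open>
  Compare weights and break ties lexicographically. Weights are natural numbers, so that 1 stays
  the smallest monomial.
\<close>
lemma monomial_ordering_refining_weight:
  fixes A :: "'v set"
  assumes "finite A"
  obtains r where "monomial_ordering A r"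
    and "\<And>\<alpha> \<beta>. \<alpha> \<in> monomials_in A \<Longrightarrow> \<beta> \<in> monomials_in A \<Longrightarrow>
           monomial_weight \<omega> \<alpha> < monomial_weight \<omega> \<beta> \<Longrightarrow> (\<alpha>, \<beta>) \<in> r"
proof -
  obtain xs where xs: "set xs = A" using assms finite_list by blast
  define key where "key \<alpha> = monomial_weight \<omega> \<alpha> # map (Poly_Mapping.lookup \<alpha>) xs" for \<alpha>
  define r where "r = {(\<alpha>, \<beta>). \<alpha> \<in> monomials_in A \<and> \<beta> \<in> monomials_in A \<and> key \<alpha> \<le> key \<beta>}"
  have key_inj: "\<alpha> = \<beta>" if "\<alpha> \<in> monomials_in A" "\<beta> \<in> monomials_in A" "key \<alpha> = key \<beta>" for \<alpha> \<beta>
  proof (rule poly_mapping_eqI)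
    fix v
    show "Poly_Mapping.lookup \<alpha> v = Poly_Mapping.lookup \<beta> v"
    proof (cases "v \<in> A")
      case True
      then show ?thesis using that(3) xs by (auto simp: key_def)
    next
      case False
      then have "v \<notin> Poly_Mapping.keys \<alpha>" "v \<notin> Poly_Mapping.keys \<beta>"
        using that by (auto simp: monomials_in_def)
      then show ?thesis by (simp add: in_keys_iff)
    qed
  qed
  have "linear_order_on (monomials_in A) r"
    unfolding linear_order_on_def partial_order_on_def preorder_on_def
  proof (intro conjI)
    show "refl_on (monomials_in A) r" by (auto simp: refl_on_def r_def)
    show "r \<subseteq> monomials_in A \<times> monomials_in A" by (auto simp: r_def)
    show "trans r" by (auto simp: trans_def r_def)
    show "antisym r" using key_inj by (auto simp: antisym_def r_def)
    show "total_on (monomials_in A) r" by (auto simp: total_on_def r_def)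
  qed
  moreover have "(0, \<alpha>) \<in> r" if "\<alpha> \<in> monomials_in A" for \<alpha>
    using that list_zero_le_map[of xs "Poly_Mapping.lookup \<alpha>"]
    by (auto simp: r_def key_def monomial_weight_def lookup_zero[abs_def] simp del: sum_eq_0_iff)
  moreover have "(\<alpha> + \<gamma>, \<beta> + \<gamma>) \<in> r" if "\<gamma> \<in> monomials_in A" "(\<alpha>, \<beta>) \<in> r" for \<alpha> \<beta> \<gamma>
    using that list_le_map_add[of "Poly_Mapping.lookup \<alpha>" xs "Poly_Mapping.lookup \<beta>" "Poly_Mapping.lookup \<gamma>"]
    by (auto simp: r_def key_def plus_poly_mapping.rep_eq)
  ultimately have "monomial_ordering A r" by (auto simp: monomial_ordering_def)
  then show ?thesis
    by (rule that) (auto simp: r_def key_def)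
qed


section \<open>Initial ideals and toric ideals\<close>

lemma leading_monomial_greatest:
  assumes r: "monomial_ordering A r" and f: "f \<in> polynomials_in A" "f \<noteq> 0"
  shows "leading_monomial r f \<in> Poly_Mapping.keys f"
    and "\<And>\<beta>. \<beta> \<in> Poly_Mapping.keys f \<Longrightarrow> (\<beta>, leading_monomial r f) \<in> r"
proof -
  have lin: "linear_order_on (monomials_in A) r" using r by (simp add: monomial_ordering_def)
  have anti: "\<alpha> = \<beta>" if "(\<alpha>, \<beta>) \<in> r" "(\<beta>, \<alpha>) \<in> r" for \<alpha> \<beta>
    using lin that unfolding linear_order_on_def partial_order_on_def by (meson antisymD)
  have trans: "(\<alpha>, \<gamma>) \<in> r" if "(\<alpha>, \<beta>) \<in> r" "(\<beta>, \<gamma>) \<in> r" for \<alpha> \<beta> \<gamma>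
    using lin that unfolding linear_order_on_def partial_order_on_def preorder_on_def
    by (meson transD)
  have total: "(\<alpha>, \<beta>) \<in> r \<or> (\<beta>, \<alpha>) \<in> r" if "\<alpha> \<in> monomials_in A" "\<beta> \<in> monomials_in A" for \<alpha> \<beta>
    using lin that
    unfolding linear_order_on_def partial_order_on_def preorder_on_def total_on_def refl_on_def
    by metis
  have "\<exists>\<alpha>\<in>S. \<forall>\<beta>\<in>S. (\<beta>, \<alpha>) \<in> r" if "finite S" "S \<noteq> {}" "S \<subseteq> monomials_in A" for S
    using that
  proof (induction rule: finite_ne_induct)
    case (singleton x)
    then show ?case using total by auto
  next
    case (insert x F)
    then obtain \<alpha> where \<alpha>: "\<alpha> \<in> F" "\<forall>\<beta>\<in>F. (\<beta>, \<alpha>) \<in> r" by auto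
    have "x \<in> monomials_in A" "\<alpha> \<in> monomials_in A" using insert.prems \<alpha> by auto
    then consider "(x, \<alpha>) \<in> r" | "(\<alpha>, x) \<in> r" "(x, x) \<in> r" using total by metis
    then show ?case
    proof cases
      case 1
      then show ?thesis using \<alpha> by auto
    next
      case 2
      then have "(\<beta>, x) \<in> r" if "\<beta> \<in> F" for \<beta> using trans \<alpha>(2) that by blast
      then show ?thesis using 2 by (intro bexI[of _ x]) auto
    qed
  qed
  moreover have "Poly_Mapping.keys f \<subseteq> monomials_in A" using f by (simp add: polynomials_in_def)
  moreover have "Poly_Mapping.keys f \<noteq> {}" using f(2) by simp
  ultimately obtain \<alpha> where "\<alpha> \<in> Poly_Mapping.keys f" "\<forall>\<beta>\<in>Poly_Mapping.keys f. (\<beta>, \<alpha>) \<in> r"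
    by (meson finite_keys)
  then have "leading_monomial r f \<in> Poly_Mapping.keys f \<and>
      (\<forall>\<beta>\<in>Poly_Mapping.keys f. (\<beta>, leading_monomial r f) \<in> r)"
    unfolding leading_monomial_def by (rule_tac theI2[of _ \<alpha>]) (auto intro: anti)
  then show "leading_monomial r f \<in> Poly_Mapping.keys f"
    and "\<And>\<beta>. \<beta> \<in> Poly_Mapping.keys f \<Longrightarrow> (\<beta>, leading_monomial r f) \<in> r" by auto
qed

lemma polynomials_in_add: "f \<in> polynomials_in A \<Longrightarrow> g \<in> polynomials_in A \<Longrightarrow> f + g \<in> polynomials_in A"
  using Poly_Mapping.keys_add[of f g] by (auto simp: polynomials_in_def)

lemma polynomials_in_mult: "f \<in> polynomials_in A \<Longrightarrow> g \<in> polynomials_in A \<Longrightarrow> f * g \<in> polynomials_in A"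
proof -
  assume "f \<in> polynomials_in A" "g \<in> polynomials_in A"
  then have "\<alpha> + \<beta> \<in> monomials_in A" if "\<alpha> \<in> Poly_Mapping.keys f" "\<beta> \<in> Poly_Mapping.keys g" for \<alpha> \<beta>
    using that by (auto simp: polynomials_in_def)
  then show ?thesis
    using keys_mult[of f g] by (auto simp: polynomials_in_def)
qed

lemma single_in_polynomials_in: "\<alpha> \<in> monomials_in A \<Longrightarrow> Poly_Mapping.single \<alpha> c \<in> polynomials_in A"
  by (auto simp: polynomials_in_def)

lemma ideal_generated_mult:
  assumes "q \<in> polynomials_in A" "g \<in> G"
  shows "q * g \<in> ideal_generated A G"
  unfolding ideal_generated_def using assms
  by (intro CollectI exI[of _ "{g}"] exI[of _ "\<lambda>_. q"]) auto

lemma ideal_generated_mono: "F \<subseteq> G \<Longrightarrow> ideal_generated A F \<subseteq> ideal_generated A G"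
  unfolding ideal_generated_def by blast

lemma ideal_generated_add:
  assumes "f \<in> ideal_generated A G" "g \<in> ideal_generated A G"
  shows "f + g \<in> ideal_generated A G"
proof -
  obtain S p where S: "f = (\<Sum>g\<in>S. p g * g)" "finite S" "S \<subseteq> G" "\<forall>g\<in>S. p g \<in> polynomials_in A"
    using assms(1) by (auto simp: ideal_generated_def)
  obtain T q where T: "g = (\<Sum>g\<in>T. q g * g)" "finite T" "T \<subseteq> G" "\<forall>g\<in>T. q g \<in> polynomials_in A"
    using assms(2) by (auto simp: ideal_generated_def)
  define c where "c h = (if h \<in> S then p h else 0) + (if h \<in> T then q h else 0)" for h
  have "f = (\<Sum>h\<in>S \<union> T. (if h \<in> S then p h else 0) * h)"
    unfolding S(1) using S(2) T(2) by (intro sum.mono_neutral_cong_left) auto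
  moreover have "g = (\<Sum>h\<in>S \<union> T. (if h \<in> T then q h else 0) * h)"
    unfolding T(1) using S(2) T(2) by (intro sum.mono_neutral_cong_left) auto
  ultimately have "f + g = (\<Sum>h\<in>S \<union> T. c h * h)"
    by (simp add: c_def distrib_right sum.distrib)
  moreover have "c h \<in> polynomials_in A" if "h \<in> S \<union> T" for h
  proof -
    have "(0 :: 'a polynomial) \<in> polynomials_in A" by (simp add: polynomials_in_def)
    then show ?thesis unfolding c_def using S(4) T(4) by (intro polynomials_in_add) auto
  qed
  ultimately show ?thesis
    unfolding ideal_generated_def using S T
    by (intro CollectI exI[of _ "S \<union> T"] exI[of _ c]) auto
qed

lemma ideal_generated_smult:
  assumes "f \<in> ideal_generated A G" "q \<in> polynomials_in A"
  shows "q * f \<in> ideal_generated A G"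
proof -
  obtain S p where S: "f = (\<Sum>g\<in>S. p g * g)" "finite S" "S \<subseteq> G" "\<forall>g\<in>S. p g \<in> polynomials_in A"
    using assms(1) by (auto simp: ideal_generated_def)
  then have "q * f = (\<Sum>g\<in>S. (q * p g) * g)"
    by (simp add: sum_distrib_left mult.assoc)
  then show ?thesis
    unfolding ideal_generated_def using S assms(2)
    by (intro CollectI exI[of _ S] exI[of _ "\<lambda>g. q * p g"]) (auto intro: polynomials_in_mult)
qed

lemma ideal_generated_subset:
  assumes "F \<subseteq> ideal_generated A G"
  shows "ideal_generated A F \<subseteq> ideal_generated A G"
proof
  fix f assume "f \<in> ideal_generated A F"
  then obtain S p where S: "f = (\<Sum>g\<in>S. p g * g)" "finite S" "S \<subseteq> F" "\<forall>g\<in>S. p g \<in> polynomials_in A"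
    by (auto simp: ideal_generated_def)
  have zero: "0 \<in> ideal_generated A G"
    unfolding ideal_generated_def by (intro CollectI exI[of _ "{}"]) auto
  have "(\<Sum>g\<in>S. p g * g) \<in> ideal_generated A G"
    using S(2-4)
  proof (induction S)
    case (insert g S)
    then show ?case using assms by (auto intro!: ideal_generated_add ideal_generated_smult)
  qed (simp add: zero)
  then show "f \<in> ideal_generated A G" by (simp add: S(1))
qed

definition monomial_value :: "(real ^ 'n) monomial \<Rightarrow> real ^ 'n" where
  "monomial_value \<alpha> = (\<Sum>m\<in>Poly_Mapping.keys \<alpha>. real (Poly_Mapping.lookup \<alpha> m) *\<^sub>R m)"

text \<open>Equality of the exponents of the two images under \<open>toric_hom\<close>.\<close>
definition same_fiber :: "(real ^ 'n) monomial \<Rightarrow> (real ^ 'n) monomial \<Rightarrow> bool" where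
  "same_fiber \<alpha> \<beta> \<longleftrightarrow>
     monomial_value \<alpha> = monomial_value \<beta> \<and> monomial_degree \<alpha> = monomial_degree \<beta>"

lemma monomial_value_add [simp]:
  "monomial_value (\<alpha> + \<beta>) = monomial_value \<alpha> + monomial_value \<beta>"
  unfolding monomial_value_def
  by (rule sum_keys_add[where h = "\<lambda>m n. real n *\<^sub>R m"]) (simp_all add: algebra_simps)

lemma monomial_value_single [simp]: "monomial_value (Poly_Mapping.single m n) = real n *\<^sub>R m"
  by (simp add: monomial_value_def)

lemma toric_hom_eq:
  "toric_hom f = (\<Sum>\<alpha>\<in>Poly_Mapping.keys f.
     Poly_Mapping.single (monomial_value \<alpha>, int (monomial_degree \<alpha>)) (Poly_Mapping.lookup f \<alpha>))"
proof -
  have pow: "Poly_Mapping.single (m, 1) 1 ^ n =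
      (Poly_Mapping.single (real n *\<^sub>R m, int n) 1 :: ((real ^ 'n) \<times> int) \<Rightarrow>\<^sub>0 complex)"
    for m :: "real ^ 'n" and n
    by (induction n) (simp_all add: mult_single algebra_simps flip: single_one zero_prod_def)
  have prod: "(\<Prod>m\<in>S. Poly_Mapping.single (h m, int (k m)) 1) =
      (Poly_Mapping.single (\<Sum>m\<in>S. h m, int (\<Sum>m\<in>S. k m)) 1 :: ((real ^ 'n) \<times> int) \<Rightarrow>\<^sub>0 complex)"
    if "finite S" for S and h :: "real ^ 'n \<Rightarrow> real ^ 'n" and k :: "real ^ 'n \<Rightarrow> nat"
    using that
    by (induction S) (simp_all add: mult_single flip: single_one zero_prod_def)
  show ?thesis
    unfolding toric_hom_def pow prod[OF finite_keys] monomial_value_def monomial_degree_def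
    by (simp add: mult_single)
qed

lemma lookup_toric_hom:
  "Poly_Mapping.lookup (toric_hom f) (x, int n) =
     (\<Sum>\<alpha>\<in>{\<alpha> \<in> Poly_Mapping.keys f. monomial_value \<alpha> = x \<and> monomial_degree \<alpha> = n}.
        Poly_Mapping.lookup f \<alpha>)"
  unfolding toric_hom_eq
  by (simp add: lookup_sum lookup_single when_def sum.inter_filter del: split_paired_All)

lemma toric_hom_binomial:
  assumes "same_fiber \<alpha> \<beta>"
  shows "toric_hom (Poly_Mapping.single \<alpha> 1 - Poly_Mapping.single \<beta> 1) = 0"
proof -
  have *: "toric_hom (Poly_Mapping.single \<alpha> c) =
        Poly_Mapping.single (monomial_value \<alpha>, int (monomial_degree \<alpha>)) c" for \<alpha> :: "(real ^ 'n) monomial" and c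
    by (simp add: toric_hom_eq)
  have "toric_hom (Poly_Mapping.single \<alpha> 1 + Poly_Mapping.single \<beta> (- 1)) = 0"
    using assms unfolding toric_hom_add * same_fiber_def by (simp flip: single_add)
  then show ?thesis by (simp add: single_uminus)
qed

text \<open>
  A relation in the toric ideal pairs its leading monomial with another monomial of the same
  fiber, since the coefficients of each fiber add up to zero. So binomials form a Groebner
  basis as soon as every monomial that is not the least of its fiber is divisible by the leading
  monomial of one of them.
\<close>
lemma toric_quadratic_groebner_basisI:
  fixes P :: "(real ^ 'n) set"
  defines "A \<equiv> lattice_points P"
  assumes fin: "finite A" and r: "monomial_ordering A r"
    and step: "\<And>\<alpha> \<beta>. \<alpha> \<in> monomials_in A \<Longrightarrow> \<beta> \<in> monomials_in A \<Longrightarrow> same_fiber \<alpha> \<beta> \<Longrightarrow> \<alpha> \<noteq> \<beta> \<Longrightarrow>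
      (\<beta>, \<alpha>) \<in> r \<Longrightarrow> \<exists>\<gamma> a b c d. \<gamma> \<in> monomials_in A \<and> {a, b, c, d} \<subseteq> A \<and> a + b = c + d \<and>
        \<alpha> = \<gamma> + (Poly_Mapping.single a 1 + Poly_Mapping.single b 1) \<and>
        Poly_Mapping.single a 1 + Poly_Mapping.single b 1 \<noteq>
          Poly_Mapping.single c 1 + Poly_Mapping.single d (1::nat) \<and>
        (Poly_Mapping.single c 1 + Poly_Mapping.single d 1,
         Poly_Mapping.single a 1 + Poly_Mapping.single b 1) \<in> r"
  shows "has_quadratic_groebner_basis A (toric_ideal P)"
proof -
  define I where "I = toric_ideal P"
  define pr :: "real ^ 'n \<Rightarrow> real ^ 'n \<Rightarrow> (real ^ 'n) monomial"
    where "pr a b = Poly_Mapping.single a 1 + Poly_Mapping.single b 1" for a b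
  define G :: "(real ^ 'n) polynomial set" where
    "G = {Poly_Mapping.single (pr a b) 1 - Poly_Mapping.single (pr c d) 1 | a b c d.
            {a, b, c, d} \<subseteq> A \<and> a + b = c + d \<and> pr a b \<noteq> pr c d}"
  have anti: "\<alpha> = \<beta>" if "(\<alpha>, \<beta>) \<in> r" "(\<beta>, \<alpha>) \<in> r" for \<alpha> \<beta>
    using r that unfolding monomial_ordering_def linear_order_on_def partial_order_on_def
    by (meson antisymD)
  have keys: "Poly_Mapping.keys (Poly_Mapping.single \<alpha> 1 - Poly_Mapping.single \<beta> (1::complex)) = {\<alpha>, \<beta>}"
    if "\<alpha> \<noteq> \<beta>" for \<alpha> \<beta> :: "(real ^ 'n) monomial"
    using that by (auto simp: in_keys_iff lookup_minus lookup_single when_def split: if_splits)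
  have "finite G"
  proof -
    have "G \<subseteq> (\<lambda>(a, b, c, d). Poly_Mapping.single (pr a b) 1 - Poly_Mapping.single (pr c d) 1) `
                (A \<times> A \<times> A \<times> A)"
      unfolding G_def by force
    then show ?thesis using fin by (meson finite_SigmaI finite_imageI finite_subset)
  qed
  moreover have GI: "G \<subseteq> I"
  proof
    fix g assume "g \<in> G"
    then obtain a b c d where g: "g = Poly_Mapping.single (pr a b) 1 - Poly_Mapping.single (pr c d) 1"
      "{a, b, c, d} \<subseteq> A" "a + b = c + d" "pr a b \<noteq> pr c d"
      unfolding G_def by blast
    have "g \<in> polynomials_in A"
      using g by (auto simp: polynomials_in_def keys pr_def)
    moreover have "same_fiber (pr a b) (pr c d)"
      using g(3) by (simp add: same_fiber_def pr_def)
    ultimately show "g \<in> I"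
      unfolding I_def toric_ideal_def using g(1) toric_hom_binomial by (simp add: A_def)
  qed
  moreover have "ideal_generated A (leading_terms r G) = ideal_generated A (leading_terms r I)"
  proof
    have "leading_terms r G \<subseteq> leading_terms r I" using GI by (auto simp: leading_terms_def)
    then show "ideal_generated A (leading_terms r G) \<subseteq> ideal_generated A (leading_terms r I)"
      by (rule ideal_generated_mono)
    have "Poly_Mapping.single (leading_monomial r f) 1 \<in> ideal_generated A (leading_terms r G)"
      if f: "f \<in> I" "f \<noteq> 0" for f
    proof -
      define \<alpha> where "\<alpha> = leading_monomial r f"
      have fA: "f \<in> polynomials_in A" and f0: "toric_hom f = 0"
        using f(1) by (auto simp: I_def toric_ideal_def A_def)
      note lead = leading_monomial_greatest[OF r fA f(2), folded \<alpha>_def]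
      have "\<exists>\<beta>. \<beta> \<in> Poly_Mapping.keys f \<and> same_fiber \<alpha> \<beta> \<and> \<beta> \<noteq> \<alpha>"
      proof (rule ccontr)
        assume "\<not> ?thesis"
        then have "{\<beta> \<in> Poly_Mapping.keys f. monomial_value \<beta> = monomial_value \<alpha> \<and>
            monomial_degree \<beta> = monomial_degree \<alpha>} = {\<alpha>}"
          using lead(1) by (auto simp: same_fiber_def)
        then have "Poly_Mapping.lookup f \<alpha> = 0"
          using lookup_toric_hom[of f "monomial_value \<alpha>" "monomial_degree \<alpha>"] f0 by simp
        then show False using lead(1) by (simp add: in_keys_iff)
      qed
      then obtain \<beta> where \<beta>: "\<beta> \<in> Poly_Mapping.keys f" "same_fiber \<alpha> \<beta>" "\<beta> \<noteq> \<alpha>" by blast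
      have "\<alpha> \<in> monomials_in A" "\<beta> \<in> monomials_in A"
        using fA lead(1) \<beta>(1) by (auto simp: polynomials_in_def)
      then obtain \<gamma> a b c d where s: "\<gamma> \<in> monomials_in A" "{a, b, c, d} \<subseteq> A" "a + b = c + d"
        "\<alpha> = \<gamma> + pr a b" "pr a b \<noteq> pr c d" "(pr c d, pr a b) \<in> r"
        using step[of \<alpha> \<beta>] \<beta> lead(2) unfolding pr_def by metis
      define g :: "(real ^ 'n) polynomial"
        where "g = Poly_Mapping.single (pr a b) 1 - Poly_Mapping.single (pr c d) 1"
      have gG: "g \<in> G" unfolding G_def g_def using s(2,3,5) by blast
      have "g \<noteq> 0" using keys[OF s(5)] unfolding g_def by force
      have "g \<in> polynomials_in A" using gG GI by (auto simp: I_def toric_ideal_def A_def)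
      note gl = leading_monomial_greatest[OF r this \<open>g \<noteq> 0\<close>]
      have "leading_monomial r g = pr a b"
      proof -
        have k: "Poly_Mapping.keys g = {pr a b, pr c d}" unfolding g_def by (rule keys[OF s(5)])
        then have "leading_monomial r g = pr a b \<or> leading_monomial r g = pr c d"
          using gl(1) by simp
        moreover have "(pr a b, leading_monomial r g) \<in> r" using gl(2) k by simp
        ultimately show ?thesis using anti s(6) by metis
      qed
      then have "Poly_Mapping.single (pr a b) 1 \<in> leading_terms r G"
        unfolding leading_terms_def using gG \<open>g \<noteq> 0\<close> by force
      then have "Poly_Mapping.single \<gamma> 1 * Poly_Mapping.single (pr a b) 1
          \<in> ideal_generated A (leading_terms r G)"
        by (intro ideal_generated_mult single_in_polynomials_in s(1))
      then show ?thesis by (simp add: mult_single s(4) flip: \<alpha>_def)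
    qed
    then have "leading_terms r I \<subseteq> ideal_generated A (leading_terms r G)"
      by (auto simp: leading_terms_def)
    then show "ideal_generated A (leading_terms r I) \<subseteq> ideal_generated A (leading_terms r G)"
      by (rule ideal_generated_subset)
  qed
  ultimately have "groebner_basis A r I G" by (simp add: groebner_basis_def)
  moreover have "g \<noteq> 0 \<and> homogeneous_of_degree 2 g" if "g \<in> G" for g
  proof -
    obtain a b c d where g: "g = Poly_Mapping.single (pr a b) 1 - Poly_Mapping.single (pr c d) 1"
      "pr a b \<noteq> pr c d"
      using \<open>g \<in> G\<close> unfolding G_def by blast
    then show ?thesis
      using keys[OF g(2)] by (auto simp: homogeneous_of_degree_def pr_def)
  qed
  ultimately show ?thesis
    unfolding has_quadratic_groebner_basis_def using r I_def by blast
qed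

section \<open>Distributive lattices of lattice points\<close>

lemma monomial_split_variable:
  fixes \<alpha> :: "'v monomial"
  assumes "a \<in> Poly_Mapping.keys \<alpha>"
  obtains \<beta> where "\<alpha> = \<beta> + Poly_Mapping.single a 1"
proof
  show "\<alpha> = (\<alpha> - Poly_Mapping.single a 1) + Poly_Mapping.single a 1"
    using assms
    by (intro poly_mapping_eqI) (auto simp: lookup_add lookup_minus lookup_single when_def in_keys_iff)
qed

lemma keys_add_nat:
  fixes \<alpha> \<beta> :: "'v monomial"
  shows "Poly_Mapping.keys (\<alpha> + \<beta>) = Poly_Mapping.keys \<alpha> \<union> Poly_Mapping.keys \<beta>"
  by (auto simp: in_keys_iff lookup_add)

text \<open>
  Points encoded as the members of a ring of sets, compatibly with addition: the binomials
  \<open>t\<^sub>a t\<^sub>b - t\<^sub>c t\<^sub>d\<close> with \<open>Y c = Y a \<inter> Y b\<close> and \<open>Y d = Y a \<union> Y b\<close> are Hibi's relations.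
  Let incomparable pairs lead, which the strict convexity of the square achieves:
  \<open>card (Y a)\<^sup>2 + card (Y b)\<^sup>2 < card (Y c)\<^sup>2 + card (Y d)\<^sup>2\<close>. The monomials that no relation
  reduces are those supported on a chain, and a fiber contains only one of them:
  the affine functions recover, for each \<open>u\<close>, how often \<open>u\<close> occurs in the sets \<open>Y m\<close>, and the largest
  set of the chain consists of the \<open>u\<close> that occur at all.
\<close>
lemma ring_of_sets_quadratic_groebner_basis:
  fixes P :: "(real ^ 'n) set" and Y :: "real ^ 'n \<Rightarrow> 'u set"
  defines "A \<equiv> lattice_points P"
  assumes finA: "finite A" and finU: "finite U"
    and YU: "\<And>m. m \<in> A \<Longrightarrow> Y m \<subseteq> U" and inj: "inj_on Y A"
    and lattice: "\<And>a b. a \<in> A \<Longrightarrow> b \<in> A \<Longrightarrow>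
           \<exists>c\<in>A. \<exists>d\<in>A. Y c = Y a \<inter> Y b \<and> Y d = Y a \<union> Y b \<and> a + b = c + d"
    and affine: "\<And>u. u \<in> U \<Longrightarrow> \<exists>p k. \<forall>m\<in>A. of_bool (u \<in> Y m) = p \<bullet> m + k"
  shows "has_quadratic_groebner_basis A (toric_ideal P)"
proof -
  define occ where "occ u = monomial_weight (\<lambda>m. of_bool (u \<in> Y m))" for u
  have occ_fiber: "occ u \<alpha> = occ u \<beta>"
    if "u \<in> U" "\<alpha> \<in> monomials_in A" "\<beta> \<in> monomials_in A" "same_fiber \<alpha> \<beta>" for u \<alpha> \<beta>
  proof -
    obtain p k where pk: "\<And>m. m \<in> A \<Longrightarrow> of_bool (u \<in> Y m) = p \<bullet> m + k"
      using affine[OF \<open>u \<in> U\<close>] by blast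
    have "real (occ u \<gamma>) = p \<bullet> monomial_value \<gamma> + k * real (monomial_degree \<gamma>)"
      if "\<gamma> \<in> monomials_in A" for \<gamma>
    proof -
      have "real (occ u \<gamma>) =
          (\<Sum>m\<in>Poly_Mapping.keys \<gamma>. real (Poly_Mapping.lookup \<gamma> m) * (p \<bullet> m + k))"
        unfolding occ_def monomial_weight_def of_nat_sum of_nat_mult
        using that by (intro sum.cong) (auto simp: monomials_in_def subset_iff simp flip: pk)
      also have "\<dots> = p \<bullet> monomial_value \<gamma> + k * real (monomial_degree \<gamma>)"
        unfolding monomial_value_def monomial_degree_def inner_sum_right of_nat_sum sum_distrib_left
          sum.distrib[symmetric]
        by (intro sum.cong refl) (simp add: algebra_simps)
      finally show ?thesis .
    qed
    then have "real (occ u \<alpha>) = real (occ u \<beta>)"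
      using that by (simp add: same_fiber_def)
    then show ?thesis by simp
  qed
  define chain where "chain \<alpha> \<longleftrightarrow>
      (\<forall>a\<in>Poly_Mapping.keys \<alpha>. \<forall>b\<in>Poly_Mapping.keys \<alpha>. Y a \<subseteq> Y b \<or> Y b \<subseteq> Y a)" for \<alpha> :: "(real ^ 'n) monomial"
  have chain_top: "\<exists>a\<in>Poly_Mapping.keys \<alpha>. Y a = {u \<in> U. occ u \<alpha> \<noteq> 0}"
    if \<alpha>: "\<alpha> \<in> monomials_in A" "chain \<alpha>" "\<alpha> \<noteq> 0" for \<alpha>
  proof -
    have K: "Poly_Mapping.keys \<alpha> \<subseteq> A" "Poly_Mapping.keys \<alpha> \<noteq> {}"
      using \<alpha> by (auto simp: monomials_in_def)
    let ?N = "(\<lambda>m. card (Y m)) ` Poly_Mapping.keys \<alpha>"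
    have "Max ?N \<in> ?N" using K(2) by (intro Max_in) auto
    then obtain a where a: "a \<in> Poly_Mapping.keys \<alpha>" "card (Y a) = Max ?N" by auto
    have le: "card (Y m) \<le> card (Y a)" if "m \<in> Poly_Mapping.keys \<alpha>" for m
      unfolding a(2) using that by (intro Max_ge) auto
    have "Y m \<subseteq> Y a" if "m \<in> Poly_Mapping.keys \<alpha>" for m
    proof -
      have "finite (Y m)" using YU K(1) that finU finite_subset by blast
      then show ?thesis using \<alpha>(2) a(1) le that by (metis card_seteq chain_def order_refl)
    qed
    then have top: "(\<exists>m\<in>Poly_Mapping.keys \<alpha>. u \<in> Y m) \<longleftrightarrow> u \<in> Y a" for u using a(1) by blast
    have "occ u \<alpha> \<noteq> 0 \<longleftrightarrow> (\<exists>m\<in>Poly_Mapping.keys \<alpha>. u \<in> Y m)" for u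
      unfolding occ_def monomial_weight_def
      by (subst sum_eq_0_iff) (simp_all add: in_keys_iff cong: bex_cong_simp)
    then show ?thesis using top a(1) YU K(1) by (intro bexI[of _ a]) auto
  qed
  have chain_unique: "\<alpha> = \<beta>"
    if "\<alpha> \<in> monomials_in A" "\<beta> \<in> monomials_in A" "same_fiber \<alpha> \<beta>" "chain \<alpha>" "chain \<beta>" for \<alpha> \<beta>
    using that
  proof (induction "monomial_degree \<alpha>" arbitrary: \<alpha> \<beta>)
    case 0
    then have "monomial_degree \<alpha> = 0" "monomial_degree \<beta> = 0" unfolding same_fiber_def by metis+
    then show ?case by simp
  next
    case (Suc n)
    have "monomial_degree \<alpha> \<noteq> 0" "monomial_degree \<beta> \<noteq> 0"
      using Suc.hyps(2) Suc.prems(3) unfolding same_fiber_def by linarith+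
    then have "\<alpha> \<noteq> 0" "\<beta> \<noteq> 0" by (simp_all only: monomial_degree_eq_0_iff not_False_eq_True)
    then obtain a b where a: "a \<in> Poly_Mapping.keys \<alpha>" "Y a = {u \<in> U. occ u \<alpha> \<noteq> 0}"
      and b: "b \<in> Poly_Mapping.keys \<beta>" "Y b = {u \<in> U. occ u \<beta> \<noteq> 0}"
      using chain_top[OF Suc.prems(1,4)] chain_top[OF Suc.prems(2,5)] by blast
    have "Y a = Y b" 
      unfolding a(2) b(2) using occ_fiber[OF _ Suc.prems(1-3)] by metis
    then have "a = b"
      using inj a(1) b(1) Suc.prems(1,2) by (auto simp: monomials_in_def dest: inj_onD)
    obtain \<alpha>' \<beta>' where s: "\<alpha> = \<alpha>' + Poly_Mapping.single a 1" "\<beta> = \<beta>' + Poly_Mapping.single a 1"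
      using a(1) b(1) \<open>a = b\<close> by (metis monomial_split_variable)
    have "\<alpha>' = \<beta>'"
    proof (rule Suc.hyps(1))
      show "n = monomial_degree \<alpha>'" using Suc.hyps(2) s(1) by simp
      show "\<alpha>' \<in> monomials_in A" "\<beta>' \<in> monomials_in A" "same_fiber \<alpha>' \<beta>'"
        using Suc.prems(1-3) by (auto simp: s same_fiber_def)
      show "chain \<alpha>'" "chain \<beta>'"
        using Suc.prems(4,5) by (auto simp: chain_def s keys_add_nat)
    qed
    then show ?case by (simp add: s)
  qed
  \<comment> \<open>Subtracting from a constant keeps the weight a natural number and reverses the order.\<close>
  define \<omega> where "\<omega> m = (card U)\<^sup>2 - (card (Y m))\<^sup>2" for m
  obtain r where r: "monomial_ordering A r"
    and weight: "\<And>\<alpha> \<beta>. \<alpha> \<in> monomials_in A \<Longrightarrow> \<beta> \<in> monomials_in A \<Longrightarrow>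
           monomial_weight \<omega> \<alpha> < monomial_weight \<omega> \<beta> \<Longrightarrow> (\<alpha>, \<beta>) \<in> r"
    using monomial_ordering_refining_weight[OF finA, of \<omega>] by blast
  have square_convex: "\<omega> c + \<omega> d < \<omega> a + \<omega> b"
    if "{a, b, c, d} \<subseteq> A" "Y c = Y a \<inter> Y b" "Y d = Y a \<union> Y b" "\<not> Y a \<subseteq> Y b" "\<not> Y b \<subseteq> Y a" for a b c d
  proof -
    note abcd = that
    have fin: "finite (Y a)" "finite (Y b)"
      using abcd(1) YU finU by (auto intro: finite_subset)
    have "card (Y a) + card (Y b) = card (Y d) + card (Y c)"
      using card_Un_Int[OF fin] abcd(2,3) by simp
    moreover have "card (Y c) < card (Y a)" "card (Y c) < card (Y b)"
      using abcd fin by (auto intro!: psubset_card_mono)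
    ultimately obtain i j where ij: "card (Y a) = card (Y c) + i" "card (Y b) = card (Y c) + j"
      "card (Y d) = card (Y c) + i + j" "0 < i" "0 < j"
      by (intro that[of "card (Y a) - card (Y c)" "card (Y b) - card (Y c)"]) simp_all
    have le: "(card (Y m))\<^sup>2 \<le> (card U)\<^sup>2" if "m \<in> A" for m
      using card_mono[OF finU YU[OF that]] by (simp add: power_mono)
    have "(card (Y a))\<^sup>2 + (card (Y b))\<^sup>2 < (card (Y c))\<^sup>2 + (card (Y d))\<^sup>2"
      using ij(4,5) unfolding ij(1-3) by (simp add: power2_eq_square algebra_simps)
    moreover have "a \<in> A" "b \<in> A" "c \<in> A" "d \<in> A" using abcd(1) by auto
    ultimately show ?thesis
      using le[of a] le[of b] le[of c] le[of d] unfolding \<omega>_def by linarith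
  qed
  have reduce: "\<exists>\<gamma> a b c d. \<gamma> \<in> monomials_in A \<and> {a, b, c, d} \<subseteq> A \<and> a + b = c + d \<and>
        \<alpha> = \<gamma> + (Poly_Mapping.single a 1 + Poly_Mapping.single b 1) \<and> \<omega> c + \<omega> d < \<omega> a + \<omega> b"
    if \<alpha>: "\<alpha> \<in> monomials_in A" "\<not> chain \<alpha>" for \<alpha>
  proof -
    obtain a b where ab: "a \<in> Poly_Mapping.keys \<alpha>" "b \<in> Poly_Mapping.keys \<alpha>"
      "\<not> Y a \<subseteq> Y b" "\<not> Y b \<subseteq> Y a"
      using \<alpha>(2) by (auto simp: chain_def)
    then have "a \<noteq> b" by blast
    obtain \<alpha>' where \<alpha>': "\<alpha> = \<alpha>' + Poly_Mapping.single b 1"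
      using ab(2) by (rule monomial_split_variable)
    then have "a \<in> Poly_Mapping.keys \<alpha>'"
      using ab(1) \<open>a \<noteq> b\<close> by (simp add: keys_add_nat)
    then obtain \<gamma> where \<gamma>: "\<alpha>' = \<gamma> + Poly_Mapping.single a 1" by (rule monomial_split_variable)
    have A: "a \<in> A" "b \<in> A" using ab(1,2) \<alpha>(1) by (auto simp: monomials_in_def)
    then obtain c d where cd: "c \<in> A" "d \<in> A" "Y c = Y a \<inter> Y b" "Y d = Y a \<union> Y b" "a + b = c + d"
      using lattice by blast
    have "\<omega> c + \<omega> d < \<omega> a + \<omega> b" using square_convex A cd ab(3,4) by simp
    moreover have "\<alpha> = \<gamma> + (Poly_Mapping.single a 1 + Poly_Mapping.single b 1)"
      by (simp add: \<alpha>' \<gamma> add.assoc)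
    moreover have "\<gamma> \<in> monomials_in A" using \<alpha>(1) by (simp add: \<alpha>' \<gamma>)
    ultimately show ?thesis using A cd by blast
  qed
  have least_chain: "chain \<mu>"
    if \<mu>: "\<mu> \<in> monomials_in A"
      and least: "\<And>\<nu>. \<nu> \<in> monomials_in A \<Longrightarrow> same_fiber \<nu> \<mu> \<Longrightarrow> monomial_weight \<omega> \<mu> \<le> monomial_weight \<omega> \<nu>"
    for \<mu>
  proof (rule ccontr)
    assume "\<not> chain \<mu>"
    then obtain \<gamma> a b c d where s: "\<gamma> \<in> monomials_in A" "{a, b, c, d} \<subseteq> A" "a + b = c + d"
      "\<mu> = \<gamma> + (Poly_Mapping.single a 1 + Poly_Mapping.single b 1)" "\<omega> c + \<omega> d < \<omega> a + \<omega> b"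
      using reduce \<mu> by meson
    let ?\<nu> = "\<gamma> + (Poly_Mapping.single c 1 + Poly_Mapping.single d 1)"
    have "?\<nu> \<in> monomials_in A" "same_fiber ?\<nu> \<mu>"
      using s(1-3) by (auto simp: s(4) same_fiber_def)
    then have "monomial_weight \<omega> \<mu> \<le> monomial_weight \<omega> ?\<nu>" by (rule least)
    then show False using s(5) by (simp add: s(4))
  qed
  show ?thesis
    unfolding A_def
  proof (rule toric_quadratic_groebner_basisI, fold A_def)
    show "finite A" "monomial_ordering A r" by (rule finA, rule r)
    fix \<alpha> \<beta>
    assume \<alpha>: "\<alpha> \<in> monomials_in A" and \<beta>: "\<beta> \<in> monomials_in A"
      and fib: "same_fiber \<alpha> \<beta>" and "\<alpha> \<noteq> \<beta>" and "(\<beta>, \<alpha>) \<in> r"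
    have anti: "\<sigma> = \<tau>" if "(\<sigma>, \<tau>) \<in> r" "(\<tau>, \<sigma>) \<in> r" for \<sigma> \<tau>
      using r that unfolding monomial_ordering_def linear_order_on_def partial_order_on_def
      by (meson antisymD)
    have le: "monomial_weight \<omega> \<beta> \<le> monomial_weight \<omega> \<alpha>"
      using weight[OF \<alpha> \<beta>] anti \<open>(\<beta>, \<alpha>) \<in> r\<close> \<open>\<alpha> \<noteq> \<beta>\<close> by force
    have "\<not> chain \<alpha>"
    proof
      assume "chain \<alpha>"
      obtain \<mu> where \<mu>: "\<mu> \<in> monomials_in A" "same_fiber \<mu> \<alpha>"
        and least: "\<And>\<nu>. \<nu> \<in> monomials_in A \<and> same_fiber \<nu> \<alpha> \<Longrightarrow> monomial_weight \<omega> \<mu> \<le> monomial_weight \<omega> \<nu>"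
        using ex_has_least_nat[of "\<lambda>\<nu>. \<nu> \<in> monomials_in A \<and> same_fiber \<nu> \<alpha>" \<alpha> "monomial_weight \<omega>"] \<alpha>
        by (auto simp: same_fiber_def)
      have "chain \<mu>" using \<mu> least by (intro least_chain) (auto simp: same_fiber_def)
      then have "\<mu> = \<alpha>" using chain_unique \<mu> \<alpha> \<open>chain \<alpha>\<close> by blast
      \<comment> \<open>Now \<open>\<alpha>\<close> has the least weight of its fiber, hence so does \<open>\<beta>\<close>, which is below it.\<close>
      then have "chain \<beta>" using \<beta> least le fib
        by (intro least_chain) (auto simp: same_fiber_def intro: order_trans)
      then show False using chain_unique \<alpha> \<beta> fib \<open>chain \<alpha>\<close> \<open>\<alpha> \<noteq> \<beta>\<close> by blast
    qed
    then obtain \<gamma> a b c d where s: "\<gamma> \<in> monomials_in A" "{a, b, c, d} \<subseteq> A" "a + b = c + d"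
      "\<alpha> = \<gamma> + (Poly_Mapping.single a 1 + Poly_Mapping.single b 1)" "\<omega> c + \<omega> d < \<omega> a + \<omega> b"
      using reduce \<alpha> by meson
    let ?cd = "Poly_Mapping.single c 1 + Poly_Mapping.single d 1 :: (real ^ 'n) monomial"
      and ?ab = "Poly_Mapping.single a 1 + Poly_Mapping.single b 1 :: (real ^ 'n) monomial"
    have lt: "monomial_weight \<omega> ?cd < monomial_weight \<omega> ?ab" using s(5) by simp
    then have "?ab \<noteq> ?cd" by (metis less_irrefl)
    moreover have "(?cd, ?ab) \<in> r" using s(2) lt by (intro weight) auto
    ultimately show "\<exists>\<gamma> a b c d. \<gamma> \<in> monomials_in A \<and> {a, b, c, d} \<subseteq> A \<and> a + b = c + d \<and>
        \<alpha> = \<gamma> + (Poly_Mapping.single a 1 + Poly_Mapping.single b 1) \<and>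
        Poly_Mapping.single a 1 + Poly_Mapping.single b 1 \<noteq>
          Poly_Mapping.single c 1 + Poly_Mapping.single d (1::nat) \<and>
        (Poly_Mapping.single c 1 + Poly_Mapping.single d 1,
         Poly_Mapping.single a 1 + Poly_Mapping.single b 1) \<in> r"
      using s(1-4) by blast
  qed
qed

section \<open>Coordinates at a smooth vertex\<close>

lemma integer_points_add: "x \<in> integer_points \<Longrightarrow> y \<in> integer_points \<Longrightarrow> x + y \<in> integer_points"
  by (simp add: integer_points_def)

lemma integer_points_diff: "x \<in> integer_points \<Longrightarrow> y \<in> integer_points \<Longrightarrow> x - y \<in> integer_points"
  by (simp add: integer_points_def)

lemma integer_points_sum: "(\<And>i. i \<in> I \<Longrightarrow> f i \<in> integer_points) \<Longrightarrow> sum f I \<in> integer_points"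
  by (auto simp: integer_points_def intro: Ints_sum)

lemma inner_integer_points: "x \<in> integer_points \<Longrightarrow> y \<in> integer_points \<Longrightarrow> x \<bullet> y \<in> \<int>"
  by (auto simp: integer_points_def inner_vec_def intro!: Ints_sum Ints_mult)

text \<open>
  The functionals are read off from the integral coordinates of the unit vectors. Duality on the
  basis is uniqueness of integral coefficients, applied to the expansion of a basis element.
\<close>
lemma lattice_basis_dual:
  fixes B :: "(real ^ 'n) set"
  assumes "is_lattice_basis B"
  obtains g where "\<And>b. b \<in> B \<Longrightarrow> g b \<in> integer_points"
    and "\<And>b b'. b \<in> B \<Longrightarrow> b' \<in> B \<Longrightarrow> g b \<bullet> b' = of_bool (b = b')"
    and "\<And>y. y = (\<Sum>b\<in>B. (g b \<bullet> y) *\<^sub>R b)"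
proof -
  have fin: "finite B" and BZ: "B \<subseteq> integer_points"
    and gen: "\<And>x. x \<in> integer_points \<Longrightarrow> \<exists>c::real ^ 'n \<Rightarrow> int. x = (\<Sum>b\<in>B. of_int (c b) *\<^sub>R b)"
    and indep: "\<And>c::real ^ 'n \<Rightarrow> int. (\<Sum>b\<in>B. of_int (c b) *\<^sub>R b) = 0 \<Longrightarrow> \<forall>b\<in>B. c b = 0"
    using assms by (auto simp: is_lattice_basis_def)
  have "axis i 1 \<in> (integer_points :: (real ^ 'n) set)" for i
    by (simp add: integer_points_def axis_def)
  then have "\<forall>i. \<exists>c::real ^ 'n \<Rightarrow> int. axis i 1 = (\<Sum>b\<in>B. of_int (c b) *\<^sub>R b)"
    using gen by blast
  then obtain c :: "'n \<Rightarrow> real ^ 'n \<Rightarrow> int"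
    where c: "\<And>i. axis i 1 = (\<Sum>b\<in>B. of_int (c i b) *\<^sub>R b)" by metis
  define g :: "real ^ 'n \<Rightarrow> real ^ 'n" where "g b = (\<chi> i. of_int (c i b))" for b
  have gZ: "g b \<in> integer_points" for b by (simp add: g_def integer_points_def)
  have expand: "y = (\<Sum>b\<in>B. (g b \<bullet> y) *\<^sub>R b)" for y
  proof -
    have "y = (\<Sum>i\<in>UNIV. (y $ i) *\<^sub>R axis i 1)"
      using basis_expansion[of y] by (simp add: scalar_mult_eq_scaleR)
    also have "\<dots> = (\<Sum>i\<in>UNIV. \<Sum>b\<in>B. (y $ i * of_int (c i b)) *\<^sub>R b)"
      by (simp add: c scaleR_sum_right)
    also have "\<dots> = (\<Sum>b\<in>B. (g b \<bullet> y) *\<^sub>R b)"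
      by (subst sum.swap) (simp add: inner_vec_def g_def scaleR_sum_left mult.commute)
    finally show ?thesis .
  qed
  have "g b \<bullet> b' = of_bool (b = b')" if b: "b \<in> B" "b' \<in> B" for b b'
  proof -
    define k where "k b = \<lfloor>g b \<bullet> b'\<rfloor> - of_bool (b = b')" for b
    have "g b \<bullet> b' \<in> \<int>" for b using gZ BZ b(2) inner_integer_points by blast
    then have k: "of_int (k b) = g b \<bullet> b' - of_bool (b = b')" for b
      by (simp add: k_def of_int_floor)
    have "(\<Sum>b\<in>B. of_int (k b) *\<^sub>R b) =
        (\<Sum>b\<in>B. (g b \<bullet> b') *\<^sub>R b) - (\<Sum>b\<in>B. of_bool (b = b') *\<^sub>R b)"
      by (simp add: k scaleR_diff_left sum_subtractf)
    also have "(\<Sum>b\<in>B. of_bool (b = b') *\<^sub>R b) = (\<Sum>b\<in>B. if b = b' then b else 0)"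
      by (intro sum.cong) auto
    also have "\<dots> = b'" using fin b(2) by simp
    finally have "\<forall>b\<in>B. k b = 0" using expand[of b'] by (intro indep) simp
    then have "k b = 0" using b(1) by blast
    then show ?thesis using k[of b] by simp
  qed
  then show ?thesis using that gZ expand by blast
qed

lemma convex_vertex_cone:
  assumes "convex P"
  shows "convex (vertex_cone P w)"
proof (rule convexI)
  fix y z and s t :: real
  assume "y \<in> vertex_cone P w" "z \<in> vertex_cone P w" and st: "0 \<le> s" "0 \<le> t" "s + t = 1"
  then obtain l x k x' where y: "y = l *\<^sub>R (x - w)" "x \<in> P" "0 \<le> l"
    and z: "z = k *\<^sub>R (x' - w)" "x' \<in> P" "0 \<le> k"
    by (auto simp: vertex_cone_def)
  define r where "r = s * l + t * k"
  show "s *\<^sub>R y + t *\<^sub>R z \<in> vertex_cone P w"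
  proof (cases "r = 0")
    case True
    then have "s * l = 0" "t * k = 0"
      using y z st by (simp_all add: r_def add_nonneg_eq_0_iff)
    then have "s *\<^sub>R y + t *\<^sub>R z = 0 *\<^sub>R (x - w)" by (auto simp: y z)
    then show ?thesis using y(2) unfolding vertex_cone_def by blast
  next
    case False
    then have r: "r > 0" using y z st by (simp add: r_def add_nonneg_eq_0_iff order_less_le)
    define x'' where "x'' = (s * l / r) *\<^sub>R x + (t * k / r) *\<^sub>R x'"
    have "x'' \<in> P"
      unfolding x''_def using r y z st assms
      by (intro convexD) (auto simp: r_def add_divide_distrib[symmetric])
    moreover have "s *\<^sub>R y + t *\<^sub>R z = r *\<^sub>R (x'' - w)"
      using r by (simp add: x''_def y z algebra_simps) (simp add: r_def algebra_simps)
    ultimately show ?thesis unfolding vertex_cone_def using r less_imp_le by blast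
  qed
qed

text \<open>A convex combination lies on a supporting hyperplane only if its summands do.\<close>
lemma supporting_functional_on_support:
  fixes f w x :: "'a::real_inner"
  assumes "finite V" "\<And>v. v \<in> V \<Longrightarrow> 0 \<le> f \<bullet> (v - w)" "\<And>v. v \<in> V \<Longrightarrow> 0 \<le> l v" "sum l V = 1"
    and "x = (\<Sum>v\<in>V. l v *\<^sub>R v)" "f \<bullet> (x - w) = 0" "v \<in> V"
  shows "l v = 0 \<or> f \<bullet> (v - w) = 0"
proof -
  have "x - w = (\<Sum>v\<in>V. l v *\<^sub>R (v - w))"
    using assms(4,5) by (simp add: scaleR_diff_right sum_subtractf flip: scaleR_sum_left)
  then have "(\<Sum>v\<in>V. l v * (f \<bullet> (v - w))) = 0"
    using assms(6) by (simp add: inner_sum_right)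
  then have "\<forall>v\<in>V. l v * (f \<bullet> (v - w)) = 0"
    using assms(1-3) by (subst (asm) sum_nonneg_eq_0_iff) auto
  then show ?thesis using assms(7) by auto
qed

text \<open>Squared norms of integer points are natural numbers, so the minimum is attained.\<close>
lemma shortest_integer_point:
  fixes E :: "(real ^ 'n) set"
  assumes "y \<in> E \<inter> integer_points - {0}"
  obtains u where "u \<in> E \<inter> integer_points - {0}" "\<And>w. w \<in> E \<inter> integer_points - {0} \<Longrightarrow> norm u \<le> norm w"
proof -
  define \<mu> where "\<mu> u = nat \<lfloor>u \<bullet> u\<rfloor>" for u :: "real ^ 'n"
  obtain u where u: "u \<in> E \<inter> integer_points - {0}"
    "\<forall>w. w \<in> E \<inter> integer_points - {0} \<longrightarrow> \<mu> u \<le> \<mu> w"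
    using ex_has_least_nat[of "\<lambda>u. u \<in> E \<inter> integer_points - {0}" y \<mu>] assms by blast
  have \<mu>: "real (\<mu> w) = w \<bullet> w" if "w \<in> integer_points" for w
  proof -
    have "of_int \<lfloor>w \<bullet> w\<rfloor> = w \<bullet> w" using inner_integer_points[OF that that] by (rule of_int_floor)
    moreover have "0 \<le> \<lfloor>w \<bullet> w\<rfloor>" by simp
    ultimately show ?thesis unfolding \<mu>_def by linarith
  qed
  have "norm u \<le> norm w" if w: "w \<in> E \<inter> integer_points - {0}" for w
  proof -
    have "real (\<mu> u) \<le> real (\<mu> w)" using u(2) w by simp
    then show ?thesis using \<mu>[of u] \<mu>[of w] u(1) w by (simp add: norm_le)
  qed
  then show ?thesis using u(1) that by blast
qed

text \<open>
  The cone at a vertex is pointed, hence generated by its rays. Cut it with a hyperplane missing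
  the apex: the section is a polytope, spanned by its vertices, and these lie on rays since a
  hyperplane exposing a vertex of the section extends to one exposing the ray through it.
\<close>
lemma vertex_cone_generated_by_rays:
  fixes P :: "(real ^ 'n) set"
  assumes P: "lattice_polytope P" and w: "w extreme_point_of P"
    and K: "convex K" "0 \<in> K" "\<And>l y. 0 \<le> l \<Longrightarrow> y \<in> K \<Longrightarrow> l *\<^sub>R y \<in> K"
    and rays: "ray_generators (vertex_cone P w) \<subseteq> K" and x: "x \<in> P"
  shows "x - w \<in> K"
proof -
  obtain V where V: "finite V" "V \<subseteq> integer_points" "P = convex hull V"
    using P by (auto simp: lattice_polytope_def)
  have wV: "w \<in> V" using w unfolding V(3) by (rule extreme_point_of_convex_hull)
  have VP: "V \<subseteq> P" unfolding V(3) by (rule hull_subset)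
  have "polyhedron P" using V(1,3) by (simp add: polyhedron_convex_hull)
  then have "{w} exposed_face_of P" using w by (simp add: exposed_face_of_polyhedron face_of_singleton)
  then obtain a b where ab: "P \<subseteq> {x. a \<bullet> x \<le> b}" "{w} = P \<inter> {x. a \<bullet> x = b}"
    unfolding exposed_face_of_def by blast
  define p where "p = - a"
  have p: "0 < p \<bullet> (v - w)" if "v \<in> P" "v \<noteq> w" for v
  proof -
    have "a \<bullet> v \<le> b" "a \<bullet> v \<noteq> b" "a \<bullet> w = b" using ab that by auto
    then show ?thesis by (simp add: p_def inner_diff_right)
  qed
  define n where "n v = (1 / (p \<bullet> (v - w))) *\<^sub>R (v - w)" for v
  have n: "v - w = (p \<bullet> (v - w)) *\<^sub>R n v" if "v \<in> V - {w}" for v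
    using p[of v] that VP by (auto simp: n_def)
  define N where "N = n ` (V - {w})"
  define Q where "Q = convex hull N"
  have finN: "finite N" using V(1) by (simp add: N_def)
  have pn: "p \<bullet> n v = 1" if "v \<in> V - {w}" for v
    using p[of v] that VP by (auto simp: n_def)
  let ?C = "vertex_cone P w"
  have convC: "convex ?C" using V(3) by (intro convex_vertex_cone) simp
  have "q \<in> K" if q: "q extreme_point_of Q" for q
  proof -
    have "polyhedron Q" using finN by (simp add: Q_def polyhedron_convex_hull)
    then have "{q} exposed_face_of Q" using q by (simp add: exposed_face_of_polyhedron face_of_singleton)
    then obtain f' c' where f': "Q \<subseteq> {x. f' \<bullet> x \<le> c'}" "{q} = Q \<inter> {x. f' \<bullet> x = c'}"
      unfolding exposed_face_of_def by blast
    \<comment> \<open>Make the functional homogeneous: zero on the ray through \<open>q\<close>, positive on the rest of the cone.\<close>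
    define f where "f = c' *\<^sub>R p - f'"
    have fn: "0 \<le> f \<bullet> n v" "f \<bullet> n v = 0 \<longrightarrow> n v = q" if "v \<in> V - {w}" for v
    proof -
      have "n v \<in> Q" unfolding Q_def N_def using that by (intro hull_inc) auto
      moreover have "f \<bullet> n v = c' - f' \<bullet> n v" using pn[OF that] by (simp add: f_def inner_diff_left)
      ultimately show "0 \<le> f \<bullet> n v" "f \<bullet> n v = 0 \<longrightarrow> n v = q" using f' by auto
    qed
    have fv: "0 \<le> f \<bullet> (v - w)" if "v \<in> V" for v
    proof (cases "v = w")
      case False
      then have v: "v \<in> V - {w}" "v \<in> P" using that VP by auto
      have "f \<bullet> (v - w) = (p \<bullet> (v - w)) * (f \<bullet> n v)"
        using n[OF v(1)] by (metis inner_scaleR_right)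
      then show ?thesis using fn(1)[OF v(1)] p[OF v(2) False] by simp
    qed simp
    define E where "E = ?C \<inter> {y. f \<bullet> y = 0}"
    have "P \<subseteq> {x. f \<bullet> x \<ge> f \<bullet> w}"
      unfolding V(3) using fv
      by (intro hull_minimal convex_halfspace_ge) (auto simp: inner_diff_right)
    then have "0 \<le> f \<bullet> y" if "y \<in> ?C" for y
      using that by (auto simp: vertex_cone_def inner_diff_right)
    then have "E face_of ?C"
      unfolding E_def using convC by (intro face_of_Int_supporting_hyperplane_ge) auto
    have "q \<in> N" using q unfolding Q_def by (rule extreme_point_of_convex_hull)
    then obtain v where v: "v \<in> V - {w}" "q = n v" by (auto simp: N_def)
    then have pv: "p \<bullet> (v - w) > 0" using p VP by auto
    have pq: "p \<bullet> q = 1" using pn v by simp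
    have fq: "f \<bullet> q = 0" using f'(2) pq by (auto simp: f_def inner_diff_left)
    have E_ray: "\<exists>t\<ge>0. y = t *\<^sub>R q" if "y \<in> E" for y
    proof -
      have fy: "f \<bullet> y = 0" using that by (simp add: E_def)
      obtain l x where y: "y = l *\<^sub>R (x - w)" "x \<in> P" "0 \<le> l"
        using \<open>y \<in> E\<close> by (auto simp: E_def vertex_cone_def)
      show ?thesis
      proof (cases "l = 0")
        case False
        then have f0: "f \<bullet> (x - w) = 0" using fy y(1) by simp
        obtain \<mu> where l: "\<And>v. v \<in> V \<Longrightarrow> 0 \<le> \<mu> v" "sum \<mu> V = 1" "(\<Sum>v\<in>V. \<mu> v *\<^sub>R v) = x"
          using y(2) V(1,3) by (auto simp: convex_hull_finite)
        have "\<mu> u *\<^sub>R (u - w) = (\<mu> u * (p \<bullet> (u - w))) *\<^sub>R q" if "u \<in> V" for u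
        proof (cases "u = w \<or> \<mu> u = 0")
          case False
          then have u: "u \<in> V - {w}" "u \<in> P" "\<mu> u \<noteq> 0" using that VP by auto
          then have "f \<bullet> (u - w) = 0"
            using supporting_functional_on_support[OF V(1) fv l(1,2) l(3)[symmetric] f0 that] by blast
          then have "f \<bullet> n u = 0" by (simp add: n_def)
          then show ?thesis using fn(2)[OF u(1)] n[OF u(1)] by (metis scaleR_scaleR)
        qed auto
        then have "(\<Sum>u\<in>V. \<mu> u *\<^sub>R (u - w)) = (\<Sum>u\<in>V. \<mu> u * (p \<bullet> (u - w))) *\<^sub>R q"
          by (simp add: scaleR_sum_left)
        moreover have "x - w = (\<Sum>u\<in>V. \<mu> u *\<^sub>R (u - w))"
          using l(2,3) by (simp add: scaleR_diff_right sum_subtractf flip: scaleR_sum_left)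
        moreover have "0 \<le> (\<Sum>u\<in>V. \<mu> u * (p \<bullet> (u - w)))"
        proof (intro sum_nonneg)
          fix u assume "u \<in> V"
          then show "0 \<le> \<mu> u * (p \<bullet> (u - w))"
            using l(1) p[of u] VP by (cases "u = w") (auto intro: less_imp_le)
        qed
        ultimately show ?thesis
          using y(1,3) by (intro exI[of _ "l * (\<Sum>u\<in>V. \<mu> u * (p \<bullet> (u - w)))"]) simp
      qed (use y in auto)
    qed
    have vE: "v - w \<in> E"
    proof -
      have "v - w \<in> ?C" unfolding vertex_cone_def using v(1) VP
        by (intro CollectI exI[of _ 1] exI[of _ v]) auto
      moreover have "f \<bullet> (v - w) = 0" using n[OF v(1)] fq v(2) by (metis inner_scaleR_right mult_zero_right)
      ultimately show ?thesis by (simp add: E_def)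
    qed
    have zE: "0 \<in> E"
    proof -
      have "0 \<in> ?C" unfolding vertex_cone_def using wV VP
        by (intro CollectI exI[of _ 0] exI[of _ w]) auto
      then show ?thesis by (simp add: E_def)
    qed
    have "aff_dim E = 1"
    proof (rule antisym)
      have "E \<subseteq> affine hull {0, q}"
      proof
        fix y assume "y \<in> E"
        then obtain t where "y = t *\<^sub>R q" using E_ray by blast
        then show "y \<in> affine hull {0, q}"
          unfolding affine_hull_2 by (intro CollectI exI[of _ "1 - t"] exI[of _ t]) simp
      qed
      then have "aff_dim E \<le> aff_dim {0, q}" by (metis aff_dim_affine_hull aff_dim_subset)
      moreover have "q \<noteq> 0" using pq by auto
      ultimately show "aff_dim E \<le> 1" by simp
      have "aff_dim {0, v - w} \<le> aff_dim E" using vE zE by (intro aff_dim_subset) auto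
      then show "1 \<le> aff_dim E" using v(1) by auto
    qed
    then have edge: "E edge_of ?C" using \<open>E face_of ?C\<close> by (simp add: edge_of_def)
    have "v - w \<in> E \<inter> integer_points - {0}"
      using vE v(1) wV V(2) by (auto intro: integer_points_diff)
    then obtain u where u: "u \<in> E \<inter> integer_points - {0}"
      "\<And>y. y \<in> E \<inter> integer_points - {0} \<Longrightarrow> norm u \<le> norm y"
      by (rule shortest_integer_point) blast
    then have uK: "u \<in> K" using edge rays unfolding ray_generators_def by blast
    obtain t where t: "0 \<le> t" "u = t *\<^sub>R q" using E_ray u(1) by blast
    then have "q = (1 / t) *\<^sub>R u" using u(1) by auto
    then show "q \<in> K" using K(3) uK t(1) by simp
  qed
  then have "{q. q extreme_point_of Q} \<subseteq> K" by blast
  then have "Q \<subseteq> K"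
    using Krein_Milman_polytope[OF finN] K(1) unfolding Q_def by (metis hull_minimal)
  have "v - w \<in> K" if "v \<in> V" for v
  proof (cases "v = w")
    case False
    then have v: "v \<in> V - {w}" using that by auto
    then have "n v \<in> Q" unfolding Q_def N_def by (intro hull_inc) auto
    moreover have "0 \<le> p \<bullet> (v - w)" using p[of v] v VP by force
    ultimately show ?thesis using n[OF v] K(3) \<open>Q \<subseteq> K\<close> by (metis subsetD)
  qed (use K(2) in simp)
  then have "V \<subseteq> (+) w ` K" by (force simp: image_iff)
  then have "P \<subseteq> (+) w ` K" unfolding V(3) using K(1) by (intro hull_minimal convex_translation)
  then show ?thesis using x by auto
qed

text \<open>
  Coordinates of \<open>P\<close> centred at \<open>w\<close>: the directions \<open>U\<close> span the cone at \<open>w\<close>, and the coordinate of \<open>x\<close> in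
  direction \<open>u\<close> is \<open>g u \<bullet> (x - w)\<close>. The functionals \<open>g u\<close> are vectors of the ambient space, not of the
  direction space of \<open>P\<close>, which keeps them integral when \<open>P\<close> is not full-dimensional.
\<close>
locale vertex_chart =
  fixes P :: "(real ^ 'n) set" and w :: "real ^ 'n"
    and U :: "(real ^ 'n) set" and g :: "real ^ 'n \<Rightarrow> real ^ 'n"
  assumes polytope: "lattice_polytope P"
    and vertex: "w \<in> P" "w \<in> integer_points"
    and finite_U: "finite U"
    and U_integer: "U \<subseteq> integer_points"
    and g_integer: "\<And>u. u \<in> U \<Longrightarrow> g u \<in> integer_points"
    and dual: "\<And>u v. u \<in> U \<Longrightarrow> v \<in> U \<Longrightarrow> g u \<bullet> v = of_bool (u = v)"
    and expand: "\<And>x. x \<in> P \<Longrightarrow> x - w = (\<Sum>u\<in>U. (g u \<bullet> (x - w)) *\<^sub>R u)"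
    and coord_nonneg: "\<And>x u. x \<in> P \<Longrightarrow> u \<in> U \<Longrightarrow> 0 \<le> g u \<bullet> (x - w)"
    and neighbour: "\<And>u. u \<in> U \<Longrightarrow> w + u \<in> P"

text \<open>
  The rays generate the cone, so the remaining elements of the lattice basis have coordinate zero on
  \<open>P\<close>. The edge in direction \<open>u\<close> ends at a lattice point \<open>w + k u\<close>, where \<open>k\<close> is a positive integer,
  and therefore passes through \<open>w + u\<close>.
\<close>
lemma smooth_vertex_chart:
  fixes P :: "(real ^ 'n) set"
  assumes P: "lattice_polytope P" and smooth: "smooth_vertex P w"
  obtains U g where "vertex_chart P w U g"
proof -
  obtain V where V: "finite V" "V \<subseteq> integer_points" "P = convex hull V"
    using P by (auto simp: lattice_polytope_def)
  have VP: "V \<subseteq> P" unfolding V(3) by (rule hull_subset)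
  have w: "w extreme_point_of P" using smooth by (simp add: smooth_vertex_def)
  have wV: "w \<in> V" using w unfolding V(3) by (rule extreme_point_of_convex_hull)
  define U where "U = ray_generators (vertex_cone P w)"
  obtain B where B: "is_lattice_basis B" "U \<subseteq> B"
    using smooth by (auto simp: smooth_vertex_def U_def)
  obtain g where g: "\<And>b. b \<in> B \<Longrightarrow> g b \<in> integer_points"
    "\<And>b b'. b \<in> B \<Longrightarrow> b' \<in> B \<Longrightarrow> g b \<bullet> b' = of_bool (b = b')"
    "\<And>y. y = (\<Sum>b\<in>B. (g b \<bullet> y) *\<^sub>R b)"
    using lattice_basis_dual[OF B(1)] by blast
  have finB: "finite B" and BZ: "B \<subseteq> integer_points" using B(1) by (auto simp: is_lattice_basis_def)
  define K where "K = {y. \<forall>b\<in>B. 0 \<le> g b \<bullet> y \<and> (b \<notin> U \<longrightarrow> g b \<bullet> y = 0)}"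
  have inK: "x - w \<in> K" if "x \<in> P" for x
  proof (rule vertex_cone_generated_by_rays[OF P w _ _ _ _ that])
    show "convex K" by (auto simp: convex_def K_def inner_add_right)
    show "ray_generators (vertex_cone P w) \<subseteq> K"
      using g(2) B(2) by (auto simp: K_def simp flip: U_def)
  qed (auto simp: K_def)
  have expand: "x - w = (\<Sum>u\<in>U. (g u \<bullet> (x - w)) *\<^sub>R u)" if "x \<in> P" for x
  proof -
    have "(\<Sum>u\<in>U. (g u \<bullet> (x - w)) *\<^sub>R u) = (\<Sum>b\<in>B. (g b \<bullet> (x - w)) *\<^sub>R b)"
      using B(2) finB inK[OF that] by (intro sum.mono_neutral_left) (auto simp: K_def)
    then show ?thesis using g(3)[of "x - w"] by simp
  qed
  have nonneg: "0 \<le> g u \<bullet> (x - w)" if "x \<in> P" "u \<in> U" for x u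
    using inK[OF that(1)] that(2) B(2) by (auto simp: K_def)
  have "w + u \<in> P" if u: "u \<in> U" for u
  proof -
    have uB: "u \<in> B" using u B(2) by blast
    obtain E where "E edge_of vertex_cone P w" "u \<in> E"
      using u by (auto simp: U_def ray_generators_def)
    then have "u \<in> vertex_cone P w" using edge_of_imp_subset by blast
    then obtain l x where lx: "u = l *\<^sub>R (x - w)" "x \<in> P" "0 \<le> l" by (auto simp: vertex_cone_def)
    have gu: "g u \<bullet> u = 1" using g(2)[OF uB uB] by simp
    then have l: "0 < l" using lx(1,3) by (cases "l = 0") auto
    obtain \<mu> where m: "\<And>v. v \<in> V \<Longrightarrow> 0 \<le> \<mu> v" "sum \<mu> V = 1" "x = (\<Sum>v\<in>V. \<mu> v *\<^sub>R v)"
      using lx(2) V(1,3) by (auto simp: convex_hull_finite)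
    have "x - w = (\<Sum>v\<in>V. \<mu> v *\<^sub>R (v - w))"
      using m(2,3) by (simp add: scaleR_diff_right sum_subtractf flip: scaleR_sum_left)
    then have "g u \<bullet> (x - w) = (\<Sum>v\<in>V. \<mu> v * (g u \<bullet> (v - w)))" by (simp add: inner_sum_right)
    moreover have "l * (g u \<bullet> (x - w)) = 1" using gu unfolding lx(1) by simp
    then have "0 < g u \<bullet> (x - w)" using l by (metis zero_less_mult_pos zero_less_one)
    ultimately obtain v where v: "v \<in> V" "\<mu> v * (g u \<bullet> (v - w)) \<noteq> 0"
      by (metis (no_types, lifting) less_irrefl sum.neutral)
    \<comment> \<open>The edge carries a generator \<open>v\<close> of the polytope other than \<open>w\<close>.\<close>
    have "g b \<bullet> (v - w) = 0" if b: "b \<in> U" "b \<noteq> u" for b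
    proof -
      have "g b \<bullet> u = 0" using g(2)[of b u] b B(2) uB by auto
      then have "g b \<bullet> (x - w) = 0" using lx(1) l by simp
      moreover have "0 \<le> g b \<bullet> (v' - w)" if "v' \<in> V" for v' using nonneg that VP b(1) by blast
      ultimately show ?thesis
        using supporting_functional_on_support[OF V(1) _ m(1,2,3) _ v(1), of "g b" w] v(2) by auto
    qed
    then have "(\<Sum>b\<in>U. (g b \<bullet> (v - w)) *\<^sub>R b) = (\<Sum>b\<in>{u}. (g b \<bullet> (v - w)) *\<^sub>R b)"
      using u finite_subset[OF B(2) finB] by (intro sum.mono_neutral_right) auto
    moreover have "v \<in> P" using v(1) VP by blast
    ultimately have vu: "v - w = (g u \<bullet> (v - w)) *\<^sub>R u" using expand[of v] by simp
    define k where "k = g u \<bullet> (v - w)"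
    have "v - w = k *\<^sub>R u" unfolding k_def by (rule vu)
    then have v_eq: "v = w + k *\<^sub>R u" by (metis add.commute diff_add_cancel)
    have "k \<in> \<int>" unfolding k_def
      using g(1)[OF uB] v(1) wV V(2) by (intro inner_integer_points integer_points_diff) auto
    moreover have "0 < k" using v(2) nonneg[of v u] v(1) VP u by (auto simp: k_def order_less_le)
    ultimately have k1: "1 \<le> k" by (auto elim!: Ints_cases)
    have "w + u = (1 - 1 / k) *\<^sub>R w + (1 / k) *\<^sub>R v"
      using \<open>0 < k\<close> unfolding v_eq by (simp add: scaleR_add_right scaleR_diff_left)
    also have "\<dots> \<in> P"
      unfolding V(3) using k1 wV v(1) by (intro convexD[OF convex_convex_hull] hull_inc) auto
    finally show ?thesis .
  qed
  moreover have "g u \<bullet> v = of_bool (u = v)" if "u \<in> U" "v \<in> U" for u v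
    using g(2)[of u v] that B(2) by blast
  ultimately have "vertex_chart P w U g"
    using P wV VP V(2) finB B(2) BZ g(1) expand nonneg
    by unfold_locales (auto intro: finite_subset)
  then show ?thesis by (rule that)
qed

lemma lattice_polytope_bounded_inner:
  fixes P :: "(real ^ 'n) set"
  assumes "lattice_polytope P"
  shows "bdd_above ((\<lambda>x. a \<bullet> x - c) ` P)"
proof -
  have "bounded P"
    using assms by (auto simp: lattice_polytope_def intro: bounded_convex_hull finite_imp_bounded)
  then obtain M where "\<And>x. x \<in> P \<Longrightarrow> norm x \<le> M" by (auto simp: bounded_iff)
  then have "a \<bullet> x - c \<le> norm a * M - c" if "x \<in> P" for x
    using norm_cauchy_schwarz[of a x] that by (smt (verit) mult_left_mono norm_ge_zero)
  then show ?thesis by (intro bdd_aboveI2)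
qed

text \<open>
  The coordinate in direction \<open>u\<close> vanishes on a facet, because that face contains \<open>w\<close> and its neighbours
  in all other directions. Its primitive normal \<open>a\<close> is a multiple of \<open>g u\<close> on the direction space, with
  factor \<open>a \<bullet> u\<close>, an integer that must be 1 by primitivity. So the coordinate is at most the width.
\<close>
lemma (in vertex_chart) coord_le_1:
  assumes comp: "compressed P" and x: "x \<in> P" and u: "u \<in> U"
  shows "g u \<bullet> (x - w) \<le> 1"
proof -
  have "convex P" using polytope by (auto simp: lattice_polytope_def)
  define F where "F = P \<inter> {x. g u \<bullet> x = g u \<bullet> w}"
  have "F face_of P"
    unfolding F_def using \<open>convex P\<close> coord_nonneg[OF _ u]
    by (intro face_of_Int_supporting_hyperplane_ge) (auto simp: inner_diff_right)
  have wF: "w \<in> F" using vertex by (simp add: F_def)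
  have vF: "w + v \<in> F" if "v \<in> U" "v \<noteq> u" for v
    using neighbour[OF that(1)] dual[OF u that(1)] that(2) by (simp add: F_def inner_add_right)
  have "w + u \<notin> F" using dual[OF u u] by (simp add: F_def inner_add_right)
  then have "aff_dim F < aff_dim P"
    using neighbour[OF u] \<open>F face_of P\<close> \<open>convex P\<close> by (intro face_of_aff_dim_lt) auto
  moreover have "aff_dim P \<le> aff_dim F + 1"
  proof -
    let ?H = "affine hull (insert (w + u) F)"
    \<comment> \<open>Together with \<open>w + u\<close> the face spans all of \<open>P\<close>.\<close>
    have "y \<in> ?H" if "y \<in> P" for y
    proof -
      have "w + (\<Sum>v\<in>T. k v *\<^sub>R v) \<in> ?H" if "T \<subseteq> U" for T and k :: "_ \<Rightarrow> real"
        using finite_subset[OF that finite_U] that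
      proof (induction T)
        case empty
        then show ?case using wF by (auto intro: hull_inc)
      next
        case (insert v T)
        have "w + v \<in> ?H" "w \<in> ?H"
          using insert.prems vF wF by (cases "v = u"; auto intro: hull_inc)+
        then have "(w + (\<Sum>v\<in>T. k v *\<^sub>R v)) + k v *\<^sub>R (w + v - w) \<in> ?H"
          using insert by (intro mem_affine_3_minus affine_affine_hull) auto
        then show ?case using insert by (simp add: algebra_simps)
      qed
      from this[of U "\<lambda>v. g v \<bullet> (y - w)"] expand[OF that] show ?thesis
        by (simp add: algebra_simps)
    qed
    then have "aff_dim P \<le> aff_dim (insert (w + u) F)"
      by (metis aff_dim_affine_hull aff_dim_subset subsetI)
    then show ?thesis by (simp add: aff_dim_insert split: if_splits)
  qed
  ultimately have "F facet_of P"
    using \<open>F face_of P\<close> wF by (auto simp: facet_of_def)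
  then obtain a c where fi: "facet_inequality P F a c" and wd: "width P a c = 1"
    using comp by (auto simp: compressed_def)
  have a: "a \<in> dual_lattice P" "a \<noteq> 0"
    and prim: "\<And>b k. b \<in> dual_lattice P \<Longrightarrow> a = real k *\<^sub>R b \<Longrightarrow> k = 1"
    and ac: "\<And>y. y \<in> P \<Longrightarrow> a \<bullet> y \<ge> c" and F: "F = {y \<in> P. a \<bullet> y = c}"
    using fi by (auto simp: facet_inequality_def primitive_in_def)
  have aw: "a \<bullet> w = c" using wF F by auto
  have av: "a \<bullet> v = 0" if "v \<in> U" "v \<noteq> u" for v
    using vF[OF that] F aw by (auto simp: inner_add_right)
  have "u \<in> direction_space P"
    unfolding direction_space_def using neighbour[OF u] vertex(1)
    by (intro span_base CollectI exI[of _ "w + u"] exI[of _ w]) simp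
  then have "a \<bullet> u \<in> \<int>" using a(1) u U_integer by (auto simp: dual_lattice_def)
  moreover have "a \<bullet> u > 0"
  proof -
    have "a \<bullet> (w + u) \<ge> c" "a \<bullet> (w + u) \<noteq> c" using ac neighbour[OF u] \<open>w + u \<notin> F\<close> F by auto
    then show ?thesis using aw by (simp add: inner_add_right)
  qed
  ultimately obtain k :: nat where k: "a \<bullet> u = real k" "k > 0"
    by (metis Ints_cases of_int_0_less_iff of_int_of_nat_eq of_nat_0_less_iff pos_int_cases)
  have a_coord: "a \<bullet> (y - w) = real k * (g u \<bullet> (y - w))" if "y \<in> P" for y
  proof -
    have "a \<bullet> (y - w) = (\<Sum>v\<in>U. (g v \<bullet> (y - w)) * (a \<bullet> v))"
      by (subst expand[OF that]) (simp add: inner_sum_right)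
    also have "\<dots> = (\<Sum>v\<in>U. if v = u then (g u \<bullet> (y - w)) * (a \<bullet> u) else 0)"
      using av by (intro sum.cong) auto
    also have "\<dots> = real k * (g u \<bullet> (y - w))" using finite_U u k(1) by simp
    finally show ?thesis .
  qed
  have a_dir: "a \<bullet> y = real k * (g u \<bullet> y)" if "y \<in> direction_space P" for y
    using that unfolding direction_space_def
  proof (induction rule: span_induct_alt)
    case (step l z y)
    then obtain z1 z2 where z: "z = z1 - z2" "z1 \<in> P" "z2 \<in> P" by blast
    have "a \<bullet> z = real k * (g u \<bullet> z)"
      using a_coord[OF z(2)] a_coord[OF z(3)] by (simp add: z(1) inner_diff_right algebra_simps)
    then show ?case using step by (simp add: inner_add_right algebra_simps)
  qed simp
  have "(1 / real k) *\<^sub>R a \<in> dual_lattice P"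
  proof -
    have "(1 / real k) *\<^sub>R a \<in> direction_space P"
      using a(1) unfolding direction_space_def dual_lattice_def by (simp add: span_scale)
    moreover have "((1 / real k) *\<^sub>R a) \<bullet> y \<in> \<int>" if "y \<in> direction_space P \<inter> integer_points" for y
      using a_dir[of y] that k(2) inner_integer_points[OF g_integer[OF u], of y] by simp
    ultimately show ?thesis by (simp add: dual_lattice_def)
  qed
  then have "k = 1" using prim[of "(1 / real k) *\<^sub>R a" k] k(2) by simp
  have "g u \<bullet> (x - w) = a \<bullet> x - c"
    using a_coord[OF x] \<open>k = 1\<close> aw by (simp add: inner_diff_right)
  also have "\<dots> \<le> width P a c"
    unfolding width_def using lattice_polytope_bounded_inner[OF polytope] x by (intro cSUP_upper)
  finally show ?thesis by (simp add: wd)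
qed

text \<open>
  Leave the polytope along a segment from a relative interior point: the last point in it lies on a
  facet. On lattice points, width one leaves only two values for the corresponding inequality.
\<close>
lemma compressed_separating_facet:
  fixes P :: "(real ^ 'n) set"
  assumes P: "lattice_polytope P" and comp: "compressed P"
    and x: "x \<in> affine hull P" "x \<notin> P"
  obtains a c where "\<And>y. y \<in> lattice_points P \<Longrightarrow> a \<bullet> y - c \<in> {0, 1}" and "a \<bullet> x < c"
proof -
  obtain V where V: "finite V" "V \<noteq> {}" "V \<subseteq> integer_points" "P = convex hull V"
    using P by (auto simp: lattice_polytope_def)
  have VP: "V \<subseteq> P" unfolding V(4) by (rule hull_subset)
  have poly: "polyhedron P" using V by (simp add: polyhedron_convex_hull)
  have conv: "convex P" and compactP: "compact P" and "P \<noteq> {}"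
    using V by (auto simp: finite_imp_compact_convex_hull)
  then obtain y where y: "y \<in> rel_interior P" using rel_interior_eq_empty by blast
  then have yP: "y \<in> P" using rel_interior_subset by blast
  have "compact (P \<inter> closed_segment y x)" using compactP by (intro compact_Int) auto
  moreover have "P \<inter> closed_segment y x \<noteq> {}" using yP by auto
  ultimately obtain z where z: "z \<in> P" "z \<in> closed_segment y x"
    and nearest: "\<And>z'. z' \<in> P \<inter> closed_segment y x \<Longrightarrow> dist x z \<le> dist x z'"
    using distance_attains_inf[of "P \<inter> closed_segment y x" x] compact_imp_closed by (metis Int_iff)
  have "z \<noteq> x" using z x by auto
  have "z \<notin> rel_interior P"
  proof
    assume "z \<in> rel_interior P"
    then obtain e where e: "e > 0" "ball z e \<inter> affine hull P \<subseteq> P"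
      by (auto simp: mem_rel_interior_ball)
    \<comment> \<open>A point of the polytope on the segment that is closer to \<open>x\<close>.\<close>
    define t where "t = min (1 / 2) (e / (2 * dist z x))"
    have t: "0 < t" "t \<le> 1 / 2" "t * dist z x < e"
      using e(1) \<open>z \<noteq> x\<close> by (auto simp: t_def min_def field_simps)
    define z' where "z' = (1 - t) *\<^sub>R z + t *\<^sub>R x"
    have dz: "z' - z = t *\<^sub>R (x - z)" "x - z' = (1 - t) *\<^sub>R (x - z)"
      by (simp_all add: z'_def algebra_simps)
    have "dist z z' < e" using t unfolding dist_norm norm_minus_commute[of z] dz(1)
      by (simp add: norm_minus_commute)
    moreover have "z' \<in> affine hull P"
      unfolding z'_def using z(1) x(1) by (intro mem_affine[OF affine_affine_hull]) (auto intro: hull_inc)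
    moreover have "z' \<in> closed_segment z x"
      unfolding z'_def closed_segment_def using t by auto
    then have "z' \<in> closed_segment y x"
      using z(2) by (meson ends_in_segment(2) subsetD subset_closed_segment)
    ultimately have "dist x z \<le> dist x z'" using e(2) nearest by auto
    moreover have "dist x z' = (1 - t) * dist x z" using t unfolding dist_norm dz(2) by simp
    moreover have "0 < t * dist x z" using t \<open>z \<noteq> x\<close> by simp
    ultimately show False by (simp add: algebra_simps)
  qed
  then have "z \<in> \<Union> {F. F facet_of P}"
    using rel_boundary_of_polyhedron[OF poly] z(1) by blast
  then obtain F where F: "F facet_of P" "z \<in> F" by blast
  obtain a c where fi: "facet_inequality P F a c" and wd: "width P a c = 1"
    using comp F(1) by (auto simp: compressed_def)
  have a: "a \<in> dual_lattice P" and ac: "\<And>y. y \<in> P \<Longrightarrow> a \<bullet> y \<ge> c" and F_eq: "F = {y \<in> P. a \<bullet> y = c}"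
    using fi by (auto simp: facet_inequality_def primitive_in_def)
  have "y \<notin> F" using y rel_boundary_of_polyhedron[OF poly] F(1) by blast
  then have y_gt: "a \<bullet> y > c" using ac[OF yP] F_eq yP by auto
  obtain s where s: "0 \<le> s" "s \<le> 1" "z = (1 - s) *\<^sub>R y + s *\<^sub>R x"
    using z(2) by (auto simp: closed_segment_def)
  have zc: "(1 - s) * (a \<bullet> y) + s * (a \<bullet> x) = c"
    using F(2) F_eq s(3) by (auto simp: inner_add_right)
  have "a \<bullet> x < c"
  proof (rule ccontr)
    assume "\<not> a \<bullet> x < c"
    then have "s * c \<le> s * (a \<bullet> x)" using s(1) by (intro mult_left_mono) auto
    moreover have "s \<noteq> 1" using s(3) \<open>z \<noteq> x\<close> by auto
    then have "(1 - s) * c < (1 - s) * (a \<bullet> y)" using s(2) y_gt by (intro mult_strict_left_mono) auto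
    ultimately have "(1 - s) * c + s * c < c" using zc by linarith
    then show False by (simp add: algebra_simps)
  qed
  moreover have "a \<bullet> v - c \<in> {0, 1}" if v: "v \<in> lattice_points P" for v
  proof -
    obtain \<mu> where m: "\<And>v. v \<in> V \<Longrightarrow> 0 \<le> \<mu> v" "sum \<mu> V = 1" "z = (\<Sum>v\<in>V. \<mu> v *\<^sub>R v)"
      using z(1) V(1,4) by (auto simp: convex_hull_finite)
    \<comment> \<open>The facet contains a lattice point \<open>v0\<close>, and \<open>a\<close> is integral on the lattice vector \<open>v - v0\<close>.\<close>
    have az: "a \<bullet> (z - z) = 0" by simp
    obtain v0 where v0: "v0 \<in> V" "\<mu> v0 \<noteq> 0" using m(2) by (metis sum.neutral zero_neq_one)
    have "\<mu> v0 = 0 \<or> a \<bullet> (v0 - z) = 0"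
      using ac VP F(2) F_eq v0(1)
      by (intro supporting_functional_on_support[OF V(1) _ m(1,2,3) az]) (auto simp: inner_diff_right)
    then have c: "a \<bullet> v0 = c" using v0(2) F(2) F_eq by (auto simp: inner_diff_right)
    have vP: "v \<in> P" "v \<in> integer_points" using v by (auto simp: lattice_points_def)
    have "v - v0 \<in> direction_space P"
      unfolding direction_space_def using vP(1) v0(1) VP by (intro span_base) auto
    moreover have "v - v0 \<in> integer_points" using vP v0(1) V(3) by (intro integer_points_diff) auto
    ultimately have "a \<bullet> (v - v0) \<in> \<int>" using a unfolding dual_lattice_def by blast
    then have "a \<bullet> v - c \<in> \<int>" using c by (simp add: inner_diff_right)
    moreover have "a \<bullet> v - c \<le> width P a c"
      unfolding width_def using lattice_polytope_bounded_inner[OF P] vP(1) by (intro cSUP_upper)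
    ultimately show ?thesis using ac[OF vP(1)] wd by (auto elim!: Ints_cases)
  qed
  ultimately show ?thesis using that by blast
qed

section \<open>Lattice points as stable sets of edge directions\<close>

text \<open>
  The functional \<open>f\<close> exposes the edge from \<open>w\<close> to \<open>z\<close>. Writing \<open>z - w\<close> as a sum of edge
  directions, \<open>f\<close> vanishes on each of them, so each one leads to a lattice point of that edge.
\<close>
lemma (in vertex_chart) exposed_edge_direction:
  assumes z: "z \<in> P" "z \<noteq> w" and fz: "f \<bullet> (z - w) = 0"
    and f_nonneg: "\<And>y. y \<in> lattice_points P \<Longrightarrow> 0 \<le> f \<bullet> (y - w)"
    and f_zero: "\<And>y. y \<in> lattice_points P \<Longrightarrow> f \<bullet> (y - w) = 0 \<Longrightarrow> y = w \<or> y = z"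
  shows "z - w \<in> U"
proof -
  have nb: "w + u \<in> lattice_points P" if "u \<in> U" for u
    using neighbour[OF that] that U_integer vertex(2)
    by (auto simp: lattice_points_def intro: integer_points_add)
  have "\<exists>u\<in>U. g u \<bullet> (z - w) \<noteq> 0"
  proof (rule ccontr)
    assume "\<not> ?thesis"
    then have "z - w = 0" by (subst expand[OF z(1)]) (simp add: sum.neutral)
    then show False using z(2) by simp
  qed
  then obtain u where u: "u \<in> U" "g u \<bullet> (z - w) \<noteq> 0" by blast
  have "f \<bullet> (z - w) = (\<Sum>v\<in>U. (g v \<bullet> (z - w)) * (f \<bullet> v))"
    by (subst expand[OF z(1)]) (simp add: inner_sum_right)
  then have "(\<Sum>v\<in>U. (g v \<bullet> (z - w)) * (f \<bullet> v)) = 0" using fz by simp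
  moreover have "0 \<le> f \<bullet> v" if "v \<in> U" for v using f_nonneg[OF nb[OF that]] by simp
  ultimately have "\<forall>v\<in>U. (g v \<bullet> (z - w)) * (f \<bullet> v) = 0"
    using coord_nonneg[OF z(1)] finite_U by (subst (asm) sum_nonneg_eq_0_iff) auto
  then have "f \<bullet> u = 0" using u by auto
  then have "w + u = w \<or> w + u = z" using f_zero[OF nb[OF u(1)]] by simp
  moreover have "u \<noteq> 0" using dual[OF u(1) u(1)] by auto
  ultimately show ?thesis using u(1) by auto
qed

locale compressed_chart = vertex_chart +
  assumes compressed: "compressed P"
begin

lemma coord_0_or_1:
  assumes "x \<in> lattice_points P" "u \<in> U"
  shows "g u \<bullet> (x - w) = 0 \<or> g u \<bullet> (x - w) = 1"
proof -
  have x: "x \<in> P" "x \<in> integer_points" using assms(1) by (auto simp: lattice_points_def)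
  have "g u \<bullet> (x - w) \<in> \<int>"
    using g_integer[OF assms(2)] x(2) vertex(2) by (intro inner_integer_points integer_points_diff)
  then show ?thesis
    using coord_nonneg[OF x(1) assms(2)] coord_le_1[OF compressed x(1) assms(2)] by (auto elim!: Ints_cases)
qed

lemma coord_sum:
  assumes "T \<subseteq> U" "u \<in> U"
  shows "g u \<bullet> \<Sum>T = of_bool (u \<in> T)"
proof -
  have "g u \<bullet> \<Sum>T = (\<Sum>v\<in>T. if u = v then 1 else 0)"
    using dual[OF assms(2)] assms(1) unfolding inner_sum_right by (intro sum.cong) auto
  then show ?thesis using finite_subset[OF assms(1) finite_U] by simp
qed

lemma lattice_point_eq:
  assumes "x \<in> lattice_points P"
  shows "x = w + \<Sum>{u \<in> U. g u \<bullet> (x - w) = 1}"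
proof -
  have "x - w = (\<Sum>u\<in>U. (g u \<bullet> (x - w)) *\<^sub>R u)"
    using assms by (intro expand) (simp add: lattice_points_def)
  also have "\<dots> = (\<Sum>u\<in>U. if g u \<bullet> (x - w) = 1 then u else 0)"
    using coord_0_or_1[OF assms] by (intro sum.cong) auto
  also have "\<dots> = \<Sum>{u \<in> U. g u \<bullet> (x - w) = 1}"
    using finite_U by (simp add: sum.inter_filter)
  finally show ?thesis by (simp add: algebra_simps)
qed

lemma finite_lattice_points: "finite (lattice_points P)"
proof -
  have "lattice_points P \<subseteq> (\<lambda>T. w + \<Sum>T) ` Pow U" using lattice_point_eq by blast
  then show ?thesis using finite_U by (meson finite_Pow_iff finite_imageI finite_subset)
qed

lemma neighbour_lattice_point: "u \<in> U \<Longrightarrow> w + u \<in> lattice_points P"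
  using neighbour U_integer vertex(2) by (auto simp: lattice_points_def intro: integer_points_add)

lemma vertex_lattice_point: "w \<in> lattice_points P"
  using vertex by (simp add: lattice_points_def)

lemma neighbour_extreme_point:
  assumes s: "s \<in> U"
  shows "(w + s) extreme_point_of P"
proof -
  \<comment> \<open>Attains its minimum over the unit cube only where the coordinate \<open>s\<close> is 1 and the others are 0.\<close>
  define f where "f = (\<Sum>u\<in>U - {s}. g u) - g s"
  have f: "f \<bullet> x - f \<bullet> w = (\<Sum>u\<in>U - {s}. g u \<bullet> (x - w)) - g s \<bullet> (x - w)" for x
    by (simp add: f_def inner_diff_left inner_diff_right inner_sum_left sum_subtractf)
  have nonneg: "0 \<le> (\<Sum>u\<in>U - {s}. g u \<bullet> (x - w))" if "x \<in> P" for x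
    using coord_nonneg[OF that] by (intro sum_nonneg) auto
  have fs: "f \<bullet> (w + s) = f \<bullet> w - 1"
    using f[of "w + s"] dual s by (simp add: sum.neutral)
  have ge: "f \<bullet> x \<ge> f \<bullet> w - 1" if "x \<in> P" for x
    using f[of x] nonneg[OF that] coord_le_1[OF compressed that s] by simp
  have "convex P" using polytope by (auto simp: lattice_polytope_def)
  then have "(P \<inter> {x. f \<bullet> x = f \<bullet> w - 1}) face_of P"
    using ge by (intro face_of_Int_supporting_hyperplane_ge) auto
  also have "P \<inter> {x. f \<bullet> x = f \<bullet> w - 1} = {w + s}"
  proof -
    have "x = w + s" if x: "x \<in> P" "f \<bullet> x = f \<bullet> w - 1" for x
    proof -
      have 0: "(\<Sum>u\<in>U - {s}. g u \<bullet> (x - w)) = 0" and 1: "g s \<bullet> (x - w) = 1"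
        using f[of x] nonneg[OF x(1)] coord_le_1[OF compressed x(1) s] x(2) by simp_all
      have "\<forall>u\<in>U - {s}. g u \<bullet> (x - w) = 0"
        using 0 coord_nonneg[OF x(1)] finite_U by (subst (asm) sum_nonneg_eq_0_iff) auto
      then have "(\<Sum>u\<in>U. (g u \<bullet> (x - w)) *\<^sub>R u) = s"
        using 1 s finite_U by (simp add: sum.remove[of U s])
      then show ?thesis using expand[OF x(1)] by (simp add: algebra_simps)
    qed
    then show ?thesis using neighbour[OF s] fs by blast
  qed
  finally show ?thesis by (simp add: face_of_singleton)
qed

text \<open>Adjacency in the graph whose stable sets are the lattice points.\<close>
definition conflict :: "real ^ 'a \<Rightarrow> real ^ 'a \<Rightarrow> bool" where
  "conflict u v \<longleftrightarrow> u \<noteq> v \<and> w + u + v \<notin> P"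

lemma conflict_sym: "conflict u v \<Longrightarrow> conflict v u"
  by (auto simp: conflict_def add.assoc add.commute[of u v])

lemma sum_in_affine_hull:
  assumes "T \<subseteq> U"
  shows "w + \<Sum>T \<in> affine hull P"
  using finite_subset[OF assms finite_U] assms
proof (induction T)
  case empty
  then show ?case using vertex(1) by (simp add: hull_inc)
next
  case (insert v T)
  have "(w + \<Sum>T) + 1 *\<^sub>R (w + v - w) \<in> affine hull P"
    using insert neighbour vertex(1)
    by (intro mem_affine_3_minus affine_affine_hull) (auto intro: hull_inc)
  then show ?case using insert by (simp add: algebra_simps)
qed

text \<open>
  Besides the coordinate facets, only facets at distance one from \<open>w\<close> cut anything off. Each of
  them bounds a sum of coordinates by 1, so a set of directions violates it only if two of its
  members do.
\<close>
lemma conflict_free_set_in_polytope: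
  assumes T: "T \<subseteq> U" and free: "\<And>u v. u \<in> T \<Longrightarrow> v \<in> T \<Longrightarrow> \<not> conflict u v"
  shows "w + \<Sum>T \<in> lattice_points P"
proof -
  have "w + \<Sum>T \<in> P"
  proof (rule ccontr)
    assume "w + \<Sum>T \<notin> P"
    then obtain a c where ac: "\<And>y. y \<in> lattice_points P \<Longrightarrow> a \<bullet> y - c \<in> {0, 1}" "a \<bullet> (w + \<Sum>T) < c"
      using compressed_separating_facet[OF polytope compressed sum_in_affine_hull[OF T]] by blast
    have w: "a \<bullet> w - c \<in> {0, 1}" using ac(1) vertex_lattice_point by blast
    have u: "a \<bullet> w + a \<bullet> u - c \<in> {0, 1}" if "u \<in> U" for u
      using ac(1)[OF neighbour_lattice_point[OF that]] by (simp add: inner_add_right)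
    have sum: "a \<bullet> w + (\<Sum>u\<in>T. a \<bullet> u) < c" using ac(2) by (simp add: inner_add_right inner_sum_right)
    have finT: "finite T" using T finite_U finite_subset by blast
    show False
    proof (cases "a \<bullet> w = c")
      case True
      then have "0 \<le> (\<Sum>u\<in>T. a \<bullet> u)" using u T by (intro sum_nonneg) force
      then show False using sum True by simp
    next
      case False
      then have aw: "a \<bullet> w = c + 1" using w by auto
      then have u01: "a \<bullet> u = 0 \<or> a \<bullet> u = -1" if "u \<in> T" for u using u[of u] T that by auto
      define C where "C = {u \<in> T. a \<bullet> u = -1}"
      have "(\<Sum>u\<in>T. a \<bullet> u) = (\<Sum>u\<in>T. if a \<bullet> u = -1 then -1 else 0)"
        using u01 by (intro sum.cong) auto
      also have "\<dots> = - real (card C)" using finT by (simp add: C_def flip: sum.inter_filter)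
      finally have "card C > 1" using sum aw by simp
      then have "\<not> card C \<le> Suc 0" by simp
      then obtain u v where uv: "u \<in> C" "v \<in> C" "u \<noteq> v"
        using finT card_le_Suc0_iff_eq[of C] by (auto simp: C_def)
      then have "\<not> conflict u v" using free by (auto simp: C_def)
      then have "w + u + v \<in> lattice_points P"
        using uv T U_integer vertex(2)
        by (auto simp: conflict_def lattice_points_def C_def intro!: integer_points_add)
      then have "a \<bullet> (w + u + v) - c \<in> {0, 1}" by (rule ac(1))
      then show False using uv aw by (auto simp: C_def inner_add_right)
    qed
  qed
  moreover have "w + \<Sum>T \<in> integer_points"
    using vertex(2) T U_integer by (intro integer_points_add integer_points_sum) auto
  ultimately show ?thesis by (simp add: lattice_points_def)
qed

lemma lattice_point_conflict_free:
  assumes x: "x \<in> lattice_points P" and u: "u \<in> U" "g u \<bullet> (x - w) = 1" and v: "v \<in> U" "g v \<bullet> (x - w) = 1"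
  shows "\<not> conflict u v"
proof
  assume uv: "conflict u v"
  have hull: "w + u + v \<in> affine hull P"
    using sum_in_affine_hull[of "{u, v}"] u(1) v(1) uv by (simp add: conflict_def add.assoc)
  then obtain a c where ac: "\<And>y. y \<in> lattice_points P \<Longrightarrow> a \<bullet> y - c \<in> {0, 1}" "a \<bullet> (w + u + v) < c"
    using compressed_separating_facet[OF polytope compressed hull] uv by (auto simp: conflict_def)
  have w: "a \<bullet> w - c \<in> {0, 1}" using ac(1) vertex_lattice_point by blast
  have nb: "a \<bullet> w + a \<bullet> t - c \<in> {0, 1}" if "t \<in> U" for t
    using ac(1)[OF neighbour_lattice_point[OF that]] by (simp add: inner_add_right)
  have "a \<bullet> w = c + 1" "a \<bullet> u = -1" "a \<bullet> v = -1"
    using w nb[OF u(1)] nb[OF v(1)] ac(2) by (auto simp: inner_add_right)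
  then have le: "a \<bullet> t \<le> 0" if "t \<in> U" for t using nb[OF that] by auto
  define T where "T = {t \<in> U. g t \<bullet> (x - w) = 1}"
  have "x = w + \<Sum>T" unfolding T_def by (rule lattice_point_eq[OF x])
  then have "a \<bullet> x = a \<bullet> w + (\<Sum>t\<in>T. a \<bullet> t)" by (simp add: inner_add_right inner_sum_right)
  also have "(\<Sum>t\<in>T. a \<bullet> t) \<le> (\<Sum>t\<in>{u, v}. a \<bullet> t)"
  proof -
    have "(\<Sum>t\<in>{u, v}. - (a \<bullet> t)) \<le> (\<Sum>t\<in>T. - (a \<bullet> t))"
      using u v le finite_U by (intro sum_mono2) (auto simp: T_def)
    then show ?thesis by (simp add: sum_negf)
  qed
  also have "(\<Sum>t\<in>{u, v}. a \<bullet> t) = -2"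
    using uv \<open>a \<bullet> u = -1\<close> \<open>a \<bullet> v = -1\<close> by (simp add: conflict_def)
  finally show False using ac(1)[OF x] \<open>a \<bullet> w = c + 1\<close> by auto
qed

text \<open>
  At \<open>w + s\<close> there are edges towards \<open>w\<close>, \<open>w + t\<^sub>1\<close> and \<open>w + t\<^sub>2\<close>. Were \<open>w + t\<^sub>1 + t\<^sub>2\<close> in the polytope, then
  \<open>t\<^sub>1 + t\<^sub>2 - s = (t\<^sub>1 - s) + (t\<^sub>2 - s) - (- s)\<close> would be a direction into the polytope
  with a negative coefficient at an edge direction. In terms of graphs: conflict partners
  of \<open>s\<close> are in conflict with each other, that is, \<open>s\<close> is simplicial.
\<close>
lemma smooth_neighbour_simplicial:
  assumes s: "s \<in> U" "smooth_vertex P (w + s)"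
    and t: "t1 \<in> U" "t2 \<in> U" "conflict s t1" "conflict s t2" "t1 \<noteq> t2"
  shows "conflict t1 t2"
proof (rule ccontr)
  assume "\<not> conflict t1 t2"
  then have t12: "w + t1 + t2 \<in> P" using t(5) by (simp add: conflict_def)
  obtain U' g' where chart: "vertex_chart P (w + s) U' g'"
    using smooth_vertex_chart[OF polytope s(2)] by blast
  interpret other: vertex_chart P "w + s" U' g' by (rule chart)
  have nonzero: "u \<noteq> 0" if "u \<in> U" for u using dual[OF that that] by auto
  have supported_on: "y = w + (g s \<bullet> (y - w)) *\<^sub>R s + (\<Sum>u\<in>R. (g u \<bullet> (y - w)) *\<^sub>R u)"
    if y: "y \<in> lattice_points P" and R: "R \<subseteq> U - {s}" "(\<Sum>u\<in>U - {s} - R. g u \<bullet> (y - w)) = 0" for y R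
  proof -
    have yP: "y \<in> P" using y by (simp add: lattice_points_def)
    have fin: "finite (U - {s} - R)" using finite_U by blast
    have "\<forall>u\<in>U - {s} - R. g u \<bullet> (y - w) = 0"
      using R(2) coord_nonneg[OF yP] fin by (subst (asm) sum_nonneg_eq_0_iff) auto
    then have "(\<Sum>u\<in>U. (g u \<bullet> (y - w)) *\<^sub>R u) = (\<Sum>u\<in>insert s R. (g u \<bullet> (y - w)) *\<^sub>R u)"
      using finite_U s(1) R(1) by (intro sum.mono_neutral_right) auto
    also have "\<dots> = (g s \<bullet> (y - w)) *\<^sub>R s + (\<Sum>u\<in>R. (g u \<bullet> (y - w)) *\<^sub>R u)"
      using R(1) finite_subset[OF R(1)] finite_U by (subst sum.insert) auto
    finally have "y - w = (g s \<bullet> (y - w)) *\<^sub>R s + (\<Sum>u\<in>R. (g u \<bullet> (y - w)) *\<^sub>R u)"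
      using expand[OF yP] by simp
    moreover have "y = w + z" if "y - w = z" for z using that by auto
    ultimately show ?thesis unfolding add.assoc by blast
  qed
  have gs: "g u \<bullet> s = 0" if "u \<in> U - {s}" for u using dual[of u s] that s(1) by simp
  have gss: "g s \<bullet> s = 1" using dual s(1) by simp
  have sum_nn: "0 \<le> (\<Sum>u\<in>U - {s} - R. g u \<bullet> (y - w))" if "y \<in> lattice_points P" for y R
    using that coord_nonneg by (intro sum_nonneg) (auto simp: lattice_points_def)
  have edge_w: "- s \<in> U'"
  proof -
    \<comment> \<open>Zero exactly on the lattice points that use no direction besides \<open>s\<close>.\<close>
    define f where "f = (\<Sum>u\<in>U - {s} - {}. g u)"
    have f: "f \<bullet> (y - (w + s)) = (\<Sum>u\<in>U - {s} - {}. g u \<bullet> (y - w))" for y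
      unfolding f_def inner_sum_left using gs by (intro sum.cong) (auto simp: inner_diff_right inner_add_right)
    have "w - (w + s) \<in> U'"
    proof (rule other.exposed_edge_direction)
      show "w \<in> P" "w \<noteq> w + s" using vertex(1) nonzero s(1) by auto
      show "f \<bullet> (w - (w + s)) = 0" unfolding f by simp
      show "0 \<le> f \<bullet> (y - (w + s))" if "y \<in> lattice_points P" for y
        unfolding f by (rule sum_nn[OF that])
      show "y = w + s \<or> y = w" if "y \<in> lattice_points P" "f \<bullet> (y - (w + s)) = 0" for y
        using supported_on[of y "{}"] that(2) coord_0_or_1[OF that(1) s(1)] that(1)
        unfolding f by auto
    qed
    then show ?thesis by simp
  qed
  have edge_t: "t - s \<in> U'" if t: "t \<in> U" "conflict s t" for t
  proof -
    have "s \<noteq> t" using t(2) by (simp add: conflict_def)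
    \<comment> \<open>Least on the lattice points that use exactly one of the conflicting directions \<open>s\<close> and \<open>t\<close>, and
      no other.\<close>
    define f where "f = (\<Sum>u\<in>U - {s} - {t}. g u) - g s - g t"
    have f: "f \<bullet> (y - (w + s)) =
        (\<Sum>u\<in>U - {s} - {t}. g u \<bullet> (y - w)) + (1 - g s \<bullet> (y - w) - g t \<bullet> (y - w))" for y
    proof -
      have "(\<Sum>u\<in>U - {s} - {t}. g u) \<bullet> (y - (w + s)) = (\<Sum>u\<in>U - {s} - {t}. g u \<bullet> (y - w))"
        unfolding inner_sum_left using gs
        by (intro sum.cong) (auto simp: inner_diff_right inner_add_right)
      moreover have "g t \<bullet> s = 0" using gs t(1) \<open>s \<noteq> t\<close> by simp
      ultimately show ?thesis
        unfolding f_def inner_diff_left using gss by (simp add: inner_diff_right inner_add_right)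
    qed
    \<comment> \<open>No lattice point uses both \<open>s\<close> and \<open>t\<close>.\<close>
    have at_most: "g s \<bullet> (y - w) + g t \<bullet> (y - w) \<le> 1" if "y \<in> lattice_points P" for y
      using coord_0_or_1[OF that s(1)] coord_0_or_1[OF that t(1)]
        lattice_point_conflict_free[OF that s(1) _ t(1)] t(2) by auto
    have tR: "{t} \<subseteq> U - {s}" using t(1) \<open>s \<noteq> t\<close> by auto
    have "w + t - (w + s) \<in> U'"
    proof (rule other.exposed_edge_direction)
      show "w + t \<in> P" "w + t \<noteq> w + s" using neighbour t(1) \<open>s \<noteq> t\<close> by auto
      have "g u \<bullet> t = of_bool (u = t)" if "u \<in> U" for u using dual that t(1) by blast
      then show "f \<bullet> (w + t - (w + s)) = 0" using t(1) s(1) \<open>s \<noteq> t\<close> unfolding f by (simp add: sum.neutral)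
      show "0 \<le> f \<bullet> (y - (w + s))" if "y \<in> lattice_points P" for y
        unfolding f using sum_nn[OF that, of "{t}"] at_most[OF that] by linarith
      show "y = w + s \<or> y = w + t" if y: "y \<in> lattice_points P" "f \<bullet> (y - (w + s)) = 0" for y
      proof -
        have 0: "(\<Sum>u\<in>U - {s} - {t}. g u \<bullet> (y - w)) = 0" "g s \<bullet> (y - w) + g t \<bullet> (y - w) = 1"
          using y(2) sum_nn[OF y(1), of "{t}"] at_most[OF y(1)] unfolding f by linarith+
        have "y = w + (g s \<bullet> (y - w)) *\<^sub>R s + (g t \<bullet> (y - w)) *\<^sub>R t"
          using supported_on[OF y(1) tR 0(1)] by simp
        moreover have "g s \<bullet> (y - w) = 0 \<or> g s \<bullet> (y - w) = 1" by (rule coord_0_or_1[OF y(1) s(1)])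
        ultimately show ?thesis using 0(2) by auto
      qed
    qed
    then show ?thesis by simp
  qed
  have t1: "t1 - s \<in> U'" and t2: "t2 - s \<in> U'" using edge_t t by auto
  have ne: "t1 - s \<noteq> - s" "t2 - s \<noteq> - s" using nonzero t(1,2) by auto
  have "g' (- s) \<bullet> (t1 - s) = 0" "g' (- s) \<bullet> (t2 - s) = 0"
    using other.dual[OF edge_w t1] other.dual[OF edge_w t2] ne by auto
  moreover have "g' (- s) \<bullet> (- s) = 1" by (subst other.dual[OF edge_w edge_w]) simp
  moreover have "w + t1 + t2 - (w + s) = (t1 - s) + (t2 - s) - (- s)" by simp
  ultimately have "g' (- s) \<bullet> (w + t1 + t2 - (w + s)) = -1"
    by (simp only: inner_add_right inner_diff_right[of _ "_ + _"])
  then show False using other.coord_nonneg[OF t12 edge_w] by simp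
qed

end

section \<open>The ring of down-sets\<close>

text \<open>
  A rank turns conflict into the comparability relation of a poset in which the elements above a
  given one form a chain. This is simpliciality of all elements but \<open>s0\<close>, and above \<open>s0\<close> there is
  nothing since it is ranked last. Lattice points are antichains; \<open>Y\<close> passes to the down-sets that
  they generate, and every down-set arises. Since an antichain meets the chain above \<open>u\<close> at most once, the
  indicator of \<open>u \<in> Y x\<close> is the sum of the coordinates in that chain. These sums determine all
  coordinates by descending induction on the rank, so identities between indicators give
  identities between points.
\<close>
lemma (in compressed_chart) quadratic_groebner_basis:
  assumes smooth: "\<And>s. s \<in> U \<Longrightarrow> s \<noteq> s0 \<Longrightarrow> smooth_vertex P (w + s)"
  shows "has_quadratic_groebner_basis (lattice_points P) (toric_ideal P)"
proof -
  obtain N :: nat and h where h: "h ` U = {i. i < N}" "inj_on h U"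
    using finite_imp_inj_to_nat_seg[OF finite_U] by blast
  have hN: "h u < N" if "u \<in> U" for u using h(1) that by blast
  define rk where "rk u = (if u = s0 then N else h u)" for u
  have rk_inj: "rk u = rk v \<Longrightarrow> u = v" if "u \<in> U" "v \<in> U" for u v
    using hN[OF that(1)] hN[OF that(2)] inj_onD[OF h(2) _ that] by (auto simp: rk_def split: if_splits)
  have rk_last: "u \<noteq> s0" if "u \<in> U" "v \<in> U" "rk u < rk v" for u v
    using hN[OF that(2)] that(3) by (auto simp: rk_def split: if_splits)
  have simplicial: "conflict t1 t2"
    if "s \<in> U" "s \<noteq> s0" "t1 \<in> U" "t2 \<in> U" "conflict s t1" "conflict s t2" "t1 \<noteq> t2" for s t1 t2
    using smooth_neighbour_simplicial[OF that(1) smooth[OF that(1,2)] that(3-7)] .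
  define below where "below u v \<longleftrightarrow> u = v \<or> conflict u v \<and> rk u < rk v" for u v
  have below_trans: "below u z" if "below u v" "below v z" "u \<in> U" "v \<in> U" "z \<in> U" for u v z
  proof (cases "u = v \<or> v = z")
    case False
    then have c: "conflict u v" "conflict v z" "rk u < rk v" "rk v < rk z"
      using that by (auto simp: below_def)
    moreover from c have "u \<noteq> z" by auto
    ultimately have "conflict u z"
      using simplicial[of v u z] conflict_sym rk_last that(3-5) by blast
    then show ?thesis using c by (simp add: below_def)
  qed (use that in auto)
  have above_chain: "conflict v z" if "below u v" "below u z" "v \<noteq> z" "u \<in> U" "v \<in> U" "z \<in> U" for u v z
  proof (cases "u = v \<or> u = z")
    case True
    then show ?thesis using that conflict_sym by (auto simp: below_def)
  next
    case False
    then have c: "conflict u v" "conflict u z" "rk u < rk v" using that by (auto simp: below_def)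
    then show ?thesis using simplicial[of u v z] rk_last that(3-6) by blast
  qed
  define up where "up u = {v \<in> U. below u v}" for u
  have fin_up: "finite (up u)" for u using finite_U by (simp add: up_def)
  define Y where "Y x = {u \<in> U. \<exists>v\<in>up u. g v \<bullet> (x - w) = 1}" for x
  have indicator: "(\<Sum>v\<in>up u. g v \<bullet> (x - w)) = of_bool (u \<in> Y x)"
    if x: "x \<in> lattice_points P" and u: "u \<in> U" for x u
  proof (cases "u \<in> Y x")
    case True
    then obtain v where v: "v \<in> up u" "g v \<bullet> (x - w) = 1" by (auto simp: Y_def)
    have "g z \<bullet> (x - w) = 0" if z: "z \<in> up u" "z \<noteq> v" for z
    proof -
      have "conflict v z" using above_chain[of u v z] u v(1) z by (auto simp: up_def)
      then show ?thesis
        using lattice_point_conflict_free[OF x _ v(2), of z] coord_0_or_1[OF x, of z] v(1) z(1)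
        by (auto simp: up_def)
    qed
    then have "(\<Sum>z\<in>up u. g z \<bullet> (x - w)) = (\<Sum>z\<in>{v}. g z \<bullet> (x - w))"
      using v(1) fin_up by (intro sum.mono_neutral_right) auto
    then show ?thesis using True v(2) by simp
  next
    case False
    then have "g v \<bullet> (x - w) = 0" if "v \<in> up u" for v
      using coord_0_or_1[OF x, of v] u that by (auto simp: Y_def up_def)
    then show ?thesis using False by (simp add: sum.neutral)
  qed
  have up_sums_determine: "c u = 0" if zero: "\<And>u. u \<in> U \<Longrightarrow> sum c (up u) = 0" and u: "u \<in> U" for c :: "_ \<Rightarrow> real" and u
    using u
  proof (induction "Suc N - rk u" arbitrary: u rule: less_induct)
    case less
    have rk_le: "rk v \<le> N" if "v \<in> U" for v using hN[OF that] by (simp add: rk_def)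
    have "c v = 0" if "v \<in> up u - {u}" for v
      using less.hyps[of v] that less.prems rk_le[of v] by (auto simp: up_def below_def)
    then have "sum c (up u) = sum c {u}"
      using less.prems fin_up by (intro sum.mono_neutral_right) (auto simp: up_def below_def)
    then show "c u = 0" using zero[OF less.prems] by simp
  qed
  have sum_eqI: "a + b = c + d"
    if abcd: "a \<in> lattice_points P" "b \<in> lattice_points P" "c \<in> lattice_points P" "d \<in> lattice_points P"
      and ind: "\<And>u. u \<in> U \<Longrightarrow> of_bool (u \<in> Y a) + of_bool (u \<in> Y b) =
        of_bool (u \<in> Y c) + (of_bool (u \<in> Y d) :: real)" for a b c d
  proof -
    let ?k = "\<lambda>u. g u \<bullet> (a - w) + g u \<bullet> (b - w) - g u \<bullet> (c - w) - g u \<bullet> (d - w)"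
    have "sum ?k (up u) = 0" if "u \<in> U" for u
      using ind[OF that] unfolding sum_subtractf sum.distrib indicator[OF _ that] abcd
      by (simp add: indicator[OF _ that] abcd)
    then have k: "?k u = 0" if "u \<in> U" for u using up_sums_determine[of ?k u] that by blast
    have ex: "x - w = (\<Sum>u\<in>U. (g u \<bullet> (x - w)) *\<^sub>R u)" if "x \<in> lattice_points P" for x
      using that by (intro expand) (simp add: lattice_points_def)
    have "(a - w) + (b - w) - (c - w) - (d - w) = (\<Sum>u\<in>U. ?k u *\<^sub>R u)"
      unfolding scaleR_diff_left scaleR_add_left sum_subtractf sum.distrib
      by (simp only: ex[OF abcd(1), symmetric] ex[OF abcd(2), symmetric] ex[OF abcd(3), symmetric]
          ex[OF abcd(4), symmetric])
    also have "\<dots> = 0" using k by (intro sum.neutral) auto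
    finally show ?thesis by (simp add: algebra_simps)
  qed
  have realize: "\<exists>x\<in>lattice_points P. Y x = D"
    if D: "D \<subseteq> U" and down: "\<And>u v. u \<in> U \<Longrightarrow> v \<in> D \<Longrightarrow> below u v \<Longrightarrow> u \<in> D" for D
  proof -
    \<comment> \<open>The maximal elements of the down-set form the antichain that generates it.\<close>
    define T where "T = {u \<in> D. \<forall>v\<in>D. below u v \<longrightarrow> v = u}"
    have TU: "T \<subseteq> U" using D by (auto simp: T_def)
    have "\<not> conflict u v" if uv: "u \<in> T" "v \<in> T" for u v
    proof
      assume "conflict u v"
      moreover from this have "u \<noteq> v" by (simp add: conflict_def)
      moreover from this have "rk u < rk v \<or> rk v < rk u"
        using rk_inj uv TU by (metis linorder_neqE_nat subsetD)
      ultimately have "below u v \<or> below v u" using conflict_sym by (auto simp: below_def)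
      then show False using uv \<open>u \<noteq> v\<close> by (auto simp: T_def)
    qed
    then have xP: "w + \<Sum>T \<in> lattice_points P" using conflict_free_set_in_polytope[OF TU] by blast
    have coord: "g v \<bullet> (w + \<Sum>T - w) = of_bool (v \<in> T)" if "v \<in> U" for v
      using coord_sum[OF TU that] by simp
    have "Y (w + \<Sum>T) = {u \<in> U. \<exists>v\<in>T. below u v}"
      unfolding Y_def up_def using coord TU by auto
    also have "\<dots> = D"
    proof (intro subset_antisym subsetI)
      fix u assume "u \<in> {u \<in> U. \<exists>v\<in>T. below u v}"
      then show "u \<in> D" using down by (auto simp: T_def)
    next
      fix u assume u: "u \<in> D"
      let ?R = "rk ` (D \<inter> up u)"
      have finR: "finite ?R" using fin_up by blast
      have "u \<in> D \<inter> up u" using u D by (auto simp: up_def below_def)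
      then have "Max ?R \<in> ?R" using finR by (intro Max_in) auto
      then obtain v where v: "v \<in> D" "v \<in> up u" "rk v = Max ?R" by auto
      have "v \<in> T"
        unfolding T_def
      proof (intro CollectI conjI ballI impI v(1))
        fix z assume z: "z \<in> D" "below v z"
        then have "z \<in> D \<inter> up u" using v u D below_trans[of u v z] by (auto simp: up_def)
        then have "rk z \<le> rk v" unfolding v(3) using finR by (intro Max_ge) auto
        then show "z = v" using z(2) by (auto simp: below_def)
      qed
      then show "u \<in> {u \<in> U. \<exists>v\<in>T. below u v}" using u D v(2) by (auto simp: up_def)
    qed
    finally show ?thesis using xP by blast
  qed
  have Y_down: "u \<in> Y x" if "v \<in> Y x" "below u v" "u \<in> U" for u v x
    using that below_trans unfolding Y_def up_def by blast
  show ?thesis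
  proof (rule ring_of_sets_quadratic_groebner_basis)
    show "finite (lattice_points P)" by (rule finite_lattice_points)
    show "finite U" by (rule finite_U)
    show "Y x \<subseteq> U" for x by (auto simp: Y_def)
    show "inj_on Y (lattice_points P)"
    proof (rule inj_onI)
      fix a b assume ab: "a \<in> lattice_points P" "b \<in> lattice_points P" "Y a = Y b"
      then have "a + a = b + b" by (intro sum_eqI) auto
      then show "a = b" by (simp flip: scaleR_2)
    qed
    show "\<exists>c\<in>lattice_points P. \<exists>d\<in>lattice_points P. Y c = Y a \<inter> Y b \<and> Y d = Y a \<union> Y b \<and> a + b = c + d"
      if ab: "a \<in> lattice_points P" "b \<in> lattice_points P" for a b
    proof -
      have YU: "Y x \<subseteq> U" for x by (auto simp: Y_def)
      obtain c where c: "c \<in> lattice_points P" "Y c = Y a \<inter> Y b"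
        using realize[of "Y a \<inter> Y b"] YU Y_down by blast
      obtain d where d: "d \<in> lattice_points P" "Y d = Y a \<union> Y b"
        using realize[of "Y a \<union> Y b"] YU Y_down by blast
      have "a + b = c + d" using ab c d by (intro sum_eqI) auto
      then show ?thesis using c d by blast
    qed
    show "\<exists>p k. \<forall>x\<in>lattice_points P. of_bool (u \<in> Y x) = p \<bullet> x + k" if u: "u \<in> U" for u
    proof (intro exI ballI)
      fix x assume "x \<in> lattice_points P"
      then show "of_bool (u \<in> Y x) = sum g (up u) \<bullet> x + (- (sum g (up u) \<bullet> w))"
        using indicator[OF _ u, of x] by (simp add: inner_sum_left inner_diff_right sum_subtractf)
    qed
  qed
qed

theorem theorem5p9:
  fixes P :: "(real ^ 'n) set"
  assumes "lattice_polytope P"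
    and "compressed P"
    and "\<exists>\<^sub>\<le>\<^sub>1 v. singular_vertex P v"
  shows "has_quadratic_groebner_basis (lattice_points P) (toric_ideal P)"
proof (cases "\<exists>w. smooth_vertex P w")
  case True
  then obtain w where "smooth_vertex P w" by blast
  then obtain U g where "vertex_chart P w U g" using smooth_vertex_chart[OF assms(1)] by blast
  then interpret compressed_chart P w U g
    using assms(2) by (simp add: compressed_chart_def compressed_chart_axioms_def)
  obtain s0 where s0: "\<And>s. s \<in> U \<Longrightarrow> s \<noteq> s0 \<Longrightarrow> smooth_vertex P (w + s)"
  proof (cases "\<exists>s\<in>U. \<not> smooth_vertex P (w + s)")
    case True
    then obtain s0 where "s0 \<in> U" "\<not> smooth_vertex P (w + s0)" by blast
    then have "smooth_vertex P (w + s)" if "s \<in> U" "s \<noteq> s0" for s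
      using assms(3) neighbour_extreme_point that unfolding Uniq_def singular_vertex_def
      by (metis add_left_cancel)
    then show ?thesis by (rule that)
  qed (use that in blast)
  show ?thesis using s0 by (rule quadratic_groebner_basis)
next
  case False
  \<comment> \<open>All vertices are singular, so there is only one and the polytope is a point.\<close>
  obtain V where V: "finite V" "V \<noteq> {}" "P = convex hull V"
    using assms(1) by (auto simp: lattice_polytope_def)
  have "x = y" if "x extreme_point_of P" "y extreme_point_of P" for x y
    using assms(3) that False by (auto simp: Uniq_def singular_vertex_def)
  then have "\<exists>v. {x. x extreme_point_of P} \<subseteq> {v}" by blast
  moreover have "P = convex hull {x. x extreme_point_of P}"
    using Krein_Milman_polytope[OF V(1)] by (simp add: V(3))
  ultimately obtain v where v: "P \<subseteq> {v}" by (metis convex_hull_singleton hull_mono)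
  then have eq: "a = b" if "a \<in> lattice_points P" "b \<in> lattice_points P" for a b
    using that by (auto simp: lattice_points_def)
  show ?thesis
  proof (rule ring_of_sets_quadratic_groebner_basis[where U = "{} :: nat set" and Y = "\<lambda>_. {}"])
    show "finite (lattice_points P)" using v by (auto simp: lattice_points_def intro: finite_subset)
    show "inj_on (\<lambda>_. {} :: nat set) (lattice_points P)" using eq by (auto intro: inj_onI)
    show "\<exists>c\<in>lattice_points P. \<exists>d\<in>lattice_points P.
        ({} :: nat set) = {} \<inter> {} \<and> ({} :: nat set) = {} \<union> {} \<and> a + b = c + d"
      if "a \<in> lattice_points P" "b \<in> lattice_points P" for a b
      using that by blast
  qed auto
qed

end
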